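(* Let $\rho\equiv\rho(t,U)$ be a weak solution of $$\partial_t \rho + \frac{\kappa}{2}\mathrm{div}_U\Big(\rho \int_{\mathbf U(d)} K(V,U) U \rho(t,V)\mu(dV)\Big)=0,\qquad U\in\mathbf U(d),\ t>0,$$ that is continuous in time (on $[0,+\infty)$) with values in the set of probability densities on $\mathbf U(d)$ (with respect to $\mu$) equipped with the weak topology. Define $$D(t):=\sup\{\|V-W\|_2 \text{ s.t. }\rho(0,\mathcal{U}(t,0)^{-1}V)\,\rho(0,\mathcal{U}(t,0)^{-1}W)>0\}.$$ Assume that $\kappa>0$ and $0\le D(0)<\sqrt2$. Then complete synchronization occurs in the solution $\rho$, i.e. $\mathrm{diam}(\mathrm{supp}(\rho(t,\cdot)))\to0$ as $t\to+\infty$, and one has $$D(0)^2e^{-2\kappa t}\big(1-\tfrac12D(0)^2(1-e^{-2\kappa t})\big)\le D(t)^2\le\frac{2D(0)^2}{(2-D(0)^2)e^{2\kappa t}+D(0)^2}$$ for all $t\ge 0$.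
   Context: $\mathbf U(d)$ is the group of unitary $d\times d$ complex matrices, $\mu$ its normalized Haar measure, $\|A\|_2=\mathrm{trace}(A^*A)^{1/2}$ the Frobenius norm, $K(V,U):=VU^*-UV^*$. Diameters are taken with respect to $\|\cdot\|_2$. The equation is understood weakly: for every $\phi\in C^1(\mathbf U(d))$, $\frac{d}{dt}\int\rho(t,U)\phi(U)\mu(dU)=\frac\kappa2\iint(d\phi(U),K(V,U)U)\rho(t,V)\rho(t,U)\mu(dV)\mu(dU)$ in the sense of distributions on $(0,+\infty)$, where $(\cdot,\cdot)$ is the duality between $T^*_U\mathbf U(d)$ and $T_U\mathbf U(d)$. $\mathcal U(t,s)$ denotes the flow on $\mathbf U(d)$ such that $t\mapsto\mathcal U(t,s)U_s$ is the solution of the Cauchy problem $\frac{dU(t)}{dt}=\frac\kappa2\int_{\mathbf U(d)}K(V,U(t))U(t)\rho(t,V)\mu(dV)$, $U(s)=U_s$; one has $\rho(t,\cdot)\mu=\mathcal U(t,0)\#(\rho(0,\cdot)\mu)$, where $\#$ denotes push-forward. *)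

theory Defs
  imports "HOL-Probability.Probability"
begin

section \<open>Matrices and the unitary group\<close>

definition cadjoint :: "complex^'n^'m \<Rightarrow> complex^'m^'n" where
  "cadjoint A = (\<chi> i j. cnj (A $ j $ i))"

definition unitary_group :: "(complex^'d^'d) set" where
  "unitary_group = {U. cadjoint U ** U = mat 1 \<and> U ** cadjoint U = mat 1}"

definition frobenius_norm :: "complex^'d^'d \<Rightarrow> real" where
  "frobenius_norm A = sqrt (Re (trace (cadjoint A ** A)))"

text \<open>The library norm on matrices is the Frobenius norm, so that \<^const>\<open>dist\<close> and
  \<^const>\<open>diameter\<close> on this type refer to it.\<close>

lemma norm_eq_frobenius_norm: "norm A = frobenius_norm A"
  for A :: "complex^'d^'d"
proof -
  have "(norm A)\<^sup>2 = (\<Sum>i\<in>UNIV. \<Sum>j\<in>UNIV. (cmod (A $ i $ j))\<^sup>2)"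
    by (simp add: norm_vec_def L2_set_def sum_nonneg)
  also have "\<dots> = Re (trace (cadjoint A ** A))"
    unfolding trace_def cadjoint_def matrix_matrix_mult_def
    by (subst sum.swap) (simp add: cmod_def power2_eq_square)
  finally show ?thesis
    by (metis frobenius_norm_def norm_ge_zero real_sqrt_unique)
qed

lemma dist_eq_frobenius_norm: "dist V W = frobenius_norm (V - W)"
  for V W :: "complex^'d^'d"
  by (simp add: dist_norm norm_eq_frobenius_norm)

definition lohe_K :: "complex^'d^'d \<Rightarrow> complex^'d^'d \<Rightarrow> complex^'d^'d" where
  "lohe_K V U = V ** cadjoint U - U ** cadjoint V"

text \<open>On a compact group left invariance and total mass one determine the Haar measure.\<close>

definition normalized_haar :: "(complex^'d^'d) measure \<Rightarrow> bool" where
  "normalized_haar \<mu> \<longleftrightarrow>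
     sets \<mu> = sets (restrict_space borel unitary_group) \<and> prob_space \<mu> \<and>
     (\<forall>A\<in>unitary_group. distr \<mu> \<mu> (\<lambda>U. A ** U) = \<mu>)"

section \<open>Probability densities\<close>

definition with_density :: "'a measure \<Rightarrow> ('a \<Rightarrow> real) \<Rightarrow> 'a measure" where
  "with_density \<mu> f = density \<mu> (\<lambda>x. ennreal (f x))"

definition prob_density :: "'a measure \<Rightarrow> ('a \<Rightarrow> real) \<Rightarrow> bool" where
  "prob_density \<mu> f \<longleftrightarrow>
     f \<in> borel_measurable \<mu> \<and> (\<forall>x\<in>space \<mu>. 0 \<le> f x) \<and> prob_space (with_density \<mu> f)"

text \<open>Continuity in time for the weak topology of probability measures: all integrals against
  continuous functions on the (compact) unitary group are continuous on \<open>[0,\<infinity>)\<close>.\<close>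

definition weakly_continuous_in_time ::
    "(complex^'d^'d) measure \<Rightarrow> (real \<Rightarrow> complex^'d^'d \<Rightarrow> real) \<Rightarrow> bool" where
  "weakly_continuous_in_time \<mu> \<rho> \<longleftrightarrow>
     (\<forall>\<phi> :: complex^'d^'d \<Rightarrow> real. continuous_on unitary_group \<phi> \<longrightarrow>
        continuous_on {0..} (\<lambda>t. \<integral>U. \<rho> t U * \<phi> U \<partial>\<mu>))"

text \<open>Densities are only defined up to null sets, so the support of a density \<open>f\<close> is the support of
  the measure \<open>f \<mu>\<close>, and not the closure of the set where a particular representative is positive.\<close>

definition measure_support :: "'a::topological_space measure \<Rightarrow> 'a set" where
  "measure_support M = {x \<in> space M. \<forall>N. open N \<and> x \<in> N \<longrightarrow> emeasure M (N \<inter> space M) > 0}"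

definition density_support :: "'a::topological_space measure \<Rightarrow> ('a \<Rightarrow> real) \<Rightarrow> 'a set" where
  "density_support \<mu> f = measure_support (with_density \<mu> f)"

section \<open>Weak solutions\<close>

text \<open>\<open>C\<^sup>1\<close> functions on the unitary group, an embedded submanifold of the space of matrices: local
  restrictions of \<open>C\<^sup>1\<close> functions of a matrix (over the reals).\<close>

definition C1_unitary :: "(complex^'d^'d \<Rightarrow> real) \<Rightarrow> bool" where
  "C1_unitary \<phi> \<longleftrightarrow>
     (\<forall>U\<in>unitary_group. \<exists>N \<Phi>. \<exists>\<Phi>' :: complex^'d^'d \<Rightarrow> (complex^'d^'d) \<Rightarrow>\<^sub>L real.
        open N \<and> U \<in> N \<and> (\<forall>A\<in>N. (\<Phi> has_derivative blinfun_apply (\<Phi>' A)) (at A)) \<and>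
        continuous_on N \<Phi>' \<and> (\<forall>A\<in>N \<inter> unitary_group. \<Phi> A = \<phi> A))"

text \<open>The derivative within the unitary group is unique only on tangent vectors, and there it is the
  differential of \<open>\<phi>\<close>. It must only be applied to tangent vectors, such as \<open>K(V,U)U\<close>.\<close>

definition unitary_differential ::
    "(complex^'d^'d \<Rightarrow> real) \<Rightarrow> complex^'d^'d \<Rightarrow> complex^'d^'d \<Rightarrow> real" where
  "unitary_differential \<phi> U X = frechet_derivative \<phi> (at U within unitary_group) X"

text \<open>Smooth functions with compact support in \<open>(0,\<infinity>)\<close>.\<close>

definition time_test_function :: "(real \<Rightarrow> real) \<Rightarrow> bool" where
  "time_test_function \<eta> \<longleftrightarrow>
     (\<forall>n t. ((deriv ^^ n) \<eta>) differentiable (at t)) \<and>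
     (\<exists>a b. 0 < a \<and> (\<forall>t. \<eta> t \<noteq> 0 \<longrightarrow> a \<le> t \<and> t \<le> b))"

definition lohe_weak_solution ::
    "real \<Rightarrow> (complex^'d^'d) measure \<Rightarrow> (real \<Rightarrow> complex^'d^'d \<Rightarrow> real) \<Rightarrow> bool" where
  "lohe_weak_solution \<kappa> \<mu> \<rho> \<longleftrightarrow>
     (\<forall>\<phi> \<eta>. C1_unitary \<phi> \<longrightarrow> time_test_function \<eta> \<longrightarrow>
        - (LBINT t:{0<..}. deriv \<eta> t * (\<integral>U. \<rho> t U * \<phi> U \<partial>\<mu>)) =
        (LBINT t:{0<..}. \<eta> t * (\<kappa> / 2 *
           (\<integral>U. (\<integral>V. unitary_differential \<phi> U (lohe_K V U ** U) * \<rho> t V * \<rho> t U \<partial>\<mu>) \<partial>\<mu>))))"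

section \<open>The flow\<close>

definition lohe_flow ::
    "real \<Rightarrow> (complex^'d^'d) measure \<Rightarrow> (real \<Rightarrow> complex^'d^'d \<Rightarrow> real) \<Rightarrow>
     (real \<Rightarrow> real \<Rightarrow> complex^'d^'d \<Rightarrow> complex^'d^'d) \<Rightarrow> bool" where
  "lohe_flow \<kappa> \<mu> \<rho> F \<longleftrightarrow>
     (\<forall>s\<ge>0. \<forall>U\<in>unitary_group. F s s U = U \<and>
        (\<forall>t\<ge>0. F t s U \<in> unitary_group \<and>
           ((\<lambda>\<tau>. F \<tau> s U) has_vector_derivative
              (\<kappa> / 2) *\<^sub>R (\<integral>V. \<rho> t V *\<^sub>R (lohe_K V (F t s U) ** F t s U) \<partial>\<mu>)) (at t within {0..})))"

definition lohe_D ::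
    "(real \<Rightarrow> complex^'d^'d \<Rightarrow> real) \<Rightarrow>
     (real \<Rightarrow> real \<Rightarrow> complex^'d^'d \<Rightarrow> complex^'d^'d) \<Rightarrow> real \<Rightarrow> real" where
  "lohe_D \<rho> F t =
     Sup {frobenius_norm (V - W) | V W. V \<in> unitary_group \<and> W \<in> unitary_group \<and>
            \<rho> 0 (inv_into unitary_group (F t 0) V) * \<rho> 0 (inv_into unitary_group (F t 0) W) > 0}"

end

theory Submission
  imports Defs
begin

text \<open>Write \<open>M t\<close> for the mean of \<open>\<rho>(t,\<cdot>)\<mu>\<close>. On the unitary group the characteristics solve the matrix
  Riccati equation \<open>U' = \<kappa>/2 (M - U M\<^sup>* U)\<close>. For two of them with difference \<open>\<delta>\<close>, the derivative of
  \<open>|\<delta>|\<^sup>2\<close> lies between \<open>-2\<kappa> |\<delta>|\<^sup>2\<close> and \<open>-2\<kappa> |\<delta>|\<^sup>2 (1 - D\<^sup>2/2)\<close>, provided that \<open>M\<close> is an average of unitary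
  matrices at distance at most \<open>D\<close> from both. The first bound gives the lower estimate, the second one
  makes \<open>D(t)\<^sup>2\<close> a subsolution of the logistic equation \<open>y' = -2\<kappa> y (1 - y/2)\<close>.

  That \<open>\<rho>(t,\<cdot>)\<mu>\<close> is the image of \<open>\<rho>(0,\<cdot>)\<mu>\<close> under the flow is a uniqueness statement for the
  transport equation with the given \<open>M\<close>. Its vector field is quadratic, so the derivative of a moment of
  degree \<open>k\<close> involves \<open>O(k)\<close> moments of degree at most \<open>k + 1\<close>; a Cauchy-Kovalevskaya
  iteration shows that the moments of the two measures coincide on short time intervals, hence always,
  and the Stone-Weierstrass theorem concludes. This avoids differentiating the flow in its initial
  datum.\<close>

section \<open>Unitary matrices and the Riccati vector field\<close>

text \<open>The push-forward identity is indispensable because the two sides of the theorem see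
  different data: \<open>lohe_D\<close> only knows \<open>\<rho> 0\<close> and the flow, whereas the
  support and the mean that drives the flow belong to \<open>\<rho> t\<close>. Only after transport
  is M an average of matrices \<open>F t 0 Z\<close> with \<open>\<rho> 0 Z > 0\<close>, as the
  sharper bound demands. In the uniqueness argument both measures are moved by the mean of the given
  solution, so the differences of their moments solve a homogeneous linear hierarchy although the
  equation itself is nonlinear. Two regularity gaps shape the proof. The weak equation only provides
  distributional derivatives for t > 0; weak continuity makes the right-hand side continuous in
  time, which upgrades the moments to classical differentiability up to t = 0. And D(t)^2 is a
  supremum that need not be differentiable, so the logistic inequality is used in integrated form,
  derived for each pair before the supremum is taken.\<close>

lemma cadjoint_nth [simp]: "cadjoint A $ i $ j = cnj (A $ j $ i)"
  by (simp add: cadjoint_def)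

lemma cadjoint_cadjoint [simp]: "cadjoint (cadjoint A) = A"
  by (simp add: vec_eq_iff)

lemma cadjoint_matrix_mult: "cadjoint (A ** B) = cadjoint B ** cadjoint A"
  for A :: "complex^'n^'m" and B :: "complex^'k^'n"
  by (simp add: vec_eq_iff matrix_matrix_mult_def mult.commute)

lemma norm_cadjoint [simp]: "norm (cadjoint A) = norm A"
  for A :: "complex^'n^'m"
proof -
  have "(norm (cadjoint A))\<^sup>2 = (norm A)\<^sup>2"
    by (simp add: norm_vec_def L2_set_def sum_nonneg) (rule sum.swap)
  then show ?thesis by simp
qed

lemma bounded_linear_cadjoint: "bounded_linear (cadjoint :: complex^'n^'m \<Rightarrow> complex^'m^'n)"
  by (rule bounded_linear_intro [where K = 1]) (simp_all add: vec_eq_iff)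

lemma norm_matrix_matrix_mult_le: "norm (A ** B) \<le> norm A * norm B"
  for A :: "complex^'n^'m" and B :: "complex^'k^'n"
proof -
  have entry: "(cmod ((A ** B) $ i $ j))\<^sup>2
      \<le> (\<Sum>k\<in>UNIV. (cmod (A $ i $ k))\<^sup>2) * (\<Sum>k\<in>UNIV. (cmod (B $ k $ j))\<^sup>2)" for i j
  proof -
    have "cmod ((A ** B) $ i $ j) \<le> (\<Sum>k\<in>UNIV. cmod (A $ i $ k) * cmod (B $ k $ j))"
      unfolding matrix_matrix_mult_def by (simp add: sum_norm_le norm_mult)
    then have "(cmod ((A ** B) $ i $ j))\<^sup>2 \<le> (\<Sum>k\<in>UNIV. cmod (A $ i $ k) * cmod (B $ k $ j))\<^sup>2"
      by (simp add: power_mono)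
    also have "\<dots> \<le> (\<Sum>k\<in>UNIV. (cmod (A $ i $ k))\<^sup>2) * (\<Sum>k\<in>UNIV. (cmod (B $ k $ j))\<^sup>2)"
      by (rule Cauchy_Schwarz_ineq_sum)
    finally show ?thesis .
  qed
  have "(norm (A ** B))\<^sup>2 = (\<Sum>i\<in>UNIV. \<Sum>j\<in>UNIV. (cmod ((A ** B) $ i $ j))\<^sup>2)"
    by (simp add: norm_vec_def L2_set_def sum_nonneg)
  also have "\<dots> \<le> (\<Sum>i\<in>UNIV. \<Sum>j\<in>UNIV.
      (\<Sum>k\<in>UNIV. (cmod (A $ i $ k))\<^sup>2) * (\<Sum>k\<in>UNIV. (cmod (B $ k $ j))\<^sup>2))"
    by (intro sum_mono entry)
  also have "\<dots> = (\<Sum>i\<in>UNIV. \<Sum>k\<in>UNIV. (cmod (A $ i $ k))\<^sup>2) *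
      (\<Sum>j\<in>UNIV. \<Sum>k\<in>UNIV. (cmod (B $ k $ j))\<^sup>2)"
    by (simp add: sum_product)
  also have "(\<Sum>j\<in>UNIV. \<Sum>k\<in>UNIV. (cmod (B $ k $ j))\<^sup>2) = (\<Sum>k\<in>UNIV. \<Sum>j\<in>UNIV. (cmod (B $ k $ j))\<^sup>2)"
    by (rule sum.swap)
  also have "(\<Sum>i\<in>UNIV. \<Sum>k\<in>UNIV. (cmod (A $ i $ k))\<^sup>2) * \<dots> = (norm A * norm B)\<^sup>2"
    by (simp add: norm_vec_def L2_set_def sum_nonneg power_mult_distrib)
  finally show ?thesis
    by (simp add: abs_le_square_iff [symmetric])
qed

lemma bounded_bilinear_matrix_matrix_mult:
  "bounded_bilinear ((**) :: complex^'n^'m \<Rightarrow> complex^'k^'n \<Rightarrow> complex^'k^'m)"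
proof
  show "\<exists>K. \<forall>(A :: complex^'n^'m) (B :: complex^'k^'n). norm (A ** B) \<le> norm A * norm B * K"
    by (intro exI [of _ 1]) (simp add: norm_matrix_matrix_mult_le)
qed (simp_all add: vec_eq_iff matrix_matrix_mult_def algebra_simps sum.distrib scaleR_sum_right)

lemmas matrix_mult_diff_left = bounded_bilinear.diff_left [OF bounded_bilinear_matrix_matrix_mult]
lemmas matrix_mult_diff_right = bounded_bilinear.diff_right [OF bounded_bilinear_matrix_matrix_mult]
lemmas continuous_on_matrix_mult [continuous_intros] =
  bounded_bilinear.continuous_on [OF bounded_bilinear_matrix_matrix_mult]
lemmas continuous_on_cadjoint [continuous_intros] =
  bounded_linear.continuous_on [OF bounded_linear_cadjoint]

lemma unitary_groupD:
  assumes "U \<in> unitary_group"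
  shows "cadjoint U ** U = mat 1" and "U ** cadjoint U = mat 1"
  using assms by (auto simp: unitary_group_def)

lemma unitary_group_cadjoint: "U \<in> unitary_group \<Longrightarrow> cadjoint U \<in> unitary_group"
  by (simp add: unitary_group_def)

lemma unitary_group_mult:
  assumes "U \<in> unitary_group" "V \<in> unitary_group"
  shows "U ** V \<in> unitary_group"
proof -
  have "cadjoint V ** cadjoint U ** (U ** V) = cadjoint V ** (cadjoint U ** U) ** V"
    and "U ** V ** (cadjoint V ** cadjoint U) = U ** (V ** cadjoint V) ** cadjoint U"
    by (simp_all only: matrix_mul_assoc)
  then show ?thesis
    using assms by (simp add: unitary_group_def cadjoint_matrix_mult)
qed

lemma norm_unitary_mult_left:
  fixes U A :: "complex^'d^'d"
  assumes "U \<in> unitary_group"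
  shows "norm (U ** A) = norm A"
proof -
  have "cadjoint (U ** A) ** (U ** A) = cadjoint A ** (cadjoint U ** U) ** A"
    by (simp only: cadjoint_matrix_mult matrix_mul_assoc)
  then show ?thesis
    using assms by (simp add: norm_eq_frobenius_norm frobenius_norm_def unitary_groupD)
qed

lemma norm_unitary_mult_right:
  fixes U A :: "complex^'d^'d"
  assumes "U \<in> unitary_group"
  shows "norm (A ** U) = norm A"
  using norm_unitary_mult_left [OF unitary_group_cadjoint [OF assms], of "cadjoint A"]
  by (metis cadjoint_matrix_mult norm_cadjoint)

lemma norm_unitary: "U \<in> unitary_group \<Longrightarrow> norm U = norm (mat 1 :: complex^'d^'d)"
  for U :: "complex^'d^'d"
  using norm_unitary_mult_left [of U "mat 1"] by simp

lemma compact_unitary_group: "compact (unitary_group :: (complex^'d^'d) set)"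
proof -
  have "closed (unitary_group :: (complex^'d^'d) set)"
    unfolding unitary_group_def
    by (intro closed_Collect_conj closed_Collect_eq continuous_intros)
  moreover have "bounded (unitary_group :: (complex^'d^'d) set)"
    unfolding bounded_iff by (metis norm_unitary order_refl)
  ultimately show ?thesis
    by (simp add: compact_eq_bounded_closed)
qed

text \<open>On unitary U this is the interaction field, written so that it is real-linear in M and a
  quadratic polynomial in U: linearity lets averages over V pass into M, the polynomial form drives
  the moment hierarchy.\<close>

definition riccati :: "complex^'d^'d \<Rightarrow> complex^'d^'d \<Rightarrow> complex^'d^'d" where
  "riccati M U = M - U ** cadjoint M ** U"

lemma lohe_K_mult:
  assumes "U \<in> unitary_group"
  shows "lohe_K V U ** U = riccati V U"
proof -
  have "V ** cadjoint U ** U = V ** (cadjoint U ** U)"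
    by (simp only: matrix_mul_assoc)
  then show ?thesis
    using assms by (simp add: lohe_K_def riccati_def matrix_mult_diff_left unitary_groupD)
qed

lemma bounded_linear_riccati: "bounded_linear (\<lambda>M. riccati M U)"
  unfolding riccati_def
  by (intro bounded_linear_sub bounded_linear_ident
      bounded_linear_compose [OF bounded_bilinear.bounded_linear_left [OF bounded_bilinear_matrix_matrix_mult]]
      bounded_linear_compose [OF bounded_bilinear.bounded_linear_right [OF bounded_bilinear_matrix_matrix_mult]]
      bounded_linear_cadjoint)

lemma continuous_on_riccati [continuous_intros]:
  "continuous_on S f \<Longrightarrow> continuous_on S g \<Longrightarrow> continuous_on S (\<lambda>x. riccati (f x) (g x))"
  unfolding riccati_def by (intro continuous_intros)

text \<open>For a unitary \<open>P\<close> the polarization identity gives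
  \<open>\<delta> \<bullet> (\<delta> P) = |\<delta>|\<^sup>2 - |\<delta> - \<delta> P|\<^sup>2 / 2\<close>; with \<open>P = Z\<^sup>* V\<close> one has \<open>\<delta> - \<delta> P = \<delta> Z\<^sup>* (Z - V)\<close>.\<close>

lemma inner_riccati_diff:
  fixes V W Z :: "complex^'d^'d"
  assumes V: "V \<in> unitary_group" and W: "W \<in> unitary_group" and Z: "Z \<in> unitary_group"
  defines "X \<equiv> (V - W) \<bullet> (riccati Z V - riccati Z W)"
  shows "- 2 * (norm (V - W))\<^sup>2 \<le> X" and "X \<le> 2 * (norm (V - W))\<^sup>2"
    and "norm (Z - V) \<le> b \<Longrightarrow> norm (Z - W) \<le> b \<Longrightarrow> X \<le> - 2 * (norm (V - W))\<^sup>2 * (1 - b\<^sup>2 / 2)"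
proof -
  define \<delta> where "\<delta> = V - W"
  define R where "R = \<delta> ** (cadjoint Z ** V)"
  define L where "L = (W ** cadjoint Z) ** \<delta>"
  \<comment> \<open>The difference of \<open>V ** cadjoint Z ** V\<close> and
    \<open>W ** cadjoint Z ** W\<close> telescopes through \<open>W ** cadjoint Z ** V\<close>; each
    half is \<open>\<delta>\<close> times a unitary matrix.\<close>
  have "riccati Z V - riccati Z W = - (R + L)"
    unfolding riccati_def R_def L_def \<delta>_def
    by (simp add: matrix_mult_diff_left matrix_mult_diff_right matrix_mul_assoc)
  then have X: "X = - (\<delta> \<bullet> R) - \<delta> \<bullet> L"
    by (simp add: X_def \<delta>_def inner_diff_right inner_add_right)
  have nR: "norm R = norm \<delta>" and nL: "norm L = norm \<delta>"
    using V W Z by (simp_all add: R_def L_def norm_unitary_mult_left norm_unitary_mult_right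
        unitary_group_mult unitary_group_cadjoint)
  have polar: "\<delta> \<bullet> A = (norm \<delta>)\<^sup>2 - (norm (\<delta> - A))\<^sup>2 / 2" if "norm A = norm \<delta>" for A
    using that dot_norm_neg [of \<delta> A] by simp
  have "\<bar>\<delta> \<bullet> R\<bar> \<le> (norm \<delta>)\<^sup>2" "\<bar>\<delta> \<bullet> L\<bar> \<le> (norm \<delta>)\<^sup>2"
    using Cauchy_Schwarz_ineq2 [of \<delta> R] Cauchy_Schwarz_ineq2 [of \<delta> L] nR nL
    by (simp_all add: power2_eq_square)
  then show "- 2 * (norm (V - W))\<^sup>2 \<le> X" "X \<le> 2 * (norm (V - W))\<^sup>2"
    unfolding X \<delta>_def by linarith+
  show "X \<le> - 2 * (norm (V - W))\<^sup>2 * (1 - b\<^sup>2 / 2)" if b: "norm (Z - V) \<le> b" "norm (Z - W) \<le> b"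
  proof -
    have "\<delta> - R = \<delta> ** (cadjoint Z ** (Z - V))" "\<delta> - L = ((Z - W) ** cadjoint Z) ** \<delta>"
      using Z by (simp_all add: R_def L_def matrix_mult_diff_left matrix_mult_diff_right unitary_groupD)
    then have "norm (\<delta> - R) \<le> norm \<delta> * norm (Z - V)" "norm (\<delta> - L) \<le> norm \<delta> * norm (Z - W)"
      using Z norm_matrix_matrix_mult_le [of \<delta> "cadjoint Z ** (Z - V)"]
        norm_matrix_matrix_mult_le [of "(Z - W) ** cadjoint Z" \<delta>]
      by (simp_all add: norm_unitary_mult_left norm_unitary_mult_right unitary_group_cadjoint mult.commute)
    then have "norm (\<delta> - R) \<le> norm \<delta> * b" "norm (\<delta> - L) \<le> norm \<delta> * b"
      using b by (meson mult_left_mono norm_ge_zero order_trans)+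
    then have "(norm (\<delta> - R))\<^sup>2 \<le> (norm \<delta>)\<^sup>2 * b\<^sup>2" "(norm (\<delta> - L))\<^sup>2 \<le> (norm \<delta>)\<^sup>2 * b\<^sup>2"
      by (metis norm_ge_zero power_mono power_mult_distrib)+
    then show ?thesis
      unfolding X polar [OF nR] polar [OF nL] by (simp add: \<delta>_def algebra_simps)
  qed
qed

section \<open>Weak derivatives in time\<close>

text \<open>Derivatives at the initial time are one-sided throughout. At the endpoints only
  continuity enters; the sign is needed strictly between them.\<close>

lemma nondecreasing_of_derivative_within:
  fixes f :: "real \<Rightarrow> real"
  assumes "a \<le> s" "s \<le> t"
    and deriv: "\<And>u. a \<le> u \<Longrightarrow> (f has_real_derivative f' u) (at u within {a..})"
    and nonneg: "\<And>u. s < u \<Longrightarrow> u < t \<Longrightarrow> 0 \<le> f' u"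
  shows "f s \<le> f t"
proof (rule DERIV_nonneg_imp_increasing_open [OF \<open>s \<le> t\<close>])
  fix u assume "s < u" "u < t"
  then have "u \<in> interior {a..}" using \<open>a \<le> s\<close> by simp
  then have "at u within {a..} = at u" by (rule at_within_interior)
  then show "\<exists>y. (f has_real_derivative y) (at u) \<and> 0 \<le> y"
    using deriv [of u] nonneg [of u] \<open>s < u\<close> \<open>u < t\<close> \<open>a \<le> s\<close> by auto
next
  have "continuous_on {a..} f"
    by (meson DERIV_continuous atLeast_iff continuous_on_eq_continuous_within deriv)
  then show "continuous_on {s..t} f"
    by (rule continuous_on_subset) (use \<open>a \<le> s\<close> in auto)
qed

lemma has_real_derivative_integral:
  fixes g :: "real \<Rightarrow> real"
  assumes "continuous_on {a..} g" and "a \<le> t"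
  shows "((\<lambda>u. integral {a..u} g) has_real_derivative g t) (at t within {a..})"
proof -
  have "((\<lambda>u. integral {a..u} g) has_real_derivative g t) (at t within {a..t + 1})"
    using assms by (intro integral_has_real_derivative) (auto intro: continuous_on_subset)
  moreover have "at t within {a..t + 1} = at t within {a..}"
    by (rule at_within_nhd [of _ "{..<t + 1}"]) auto
  ultimately show ?thesis by simp
qed

text \<open>Dominated convergence along sequences of difference quotients; the mean value bound on
  the convex half-line supplies the constant dominating function.\<close>

lemma has_real_derivative_lebesgue_integral:
  fixes q q' :: "real \<Rightarrow> 'a \<Rightarrow> real"
  assumes "finite_measure M" and t: "a \<le> t"
    and q: "\<And>s. a \<le> s \<Longrightarrow> integrable M (q s)" and q': "q' t \<in> borel_measurable M"
    and deriv: "\<And>x s. x \<in> space M \<Longrightarrow> a \<le> s \<Longrightarrow>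
      ((\<lambda>u. q u x) has_real_derivative q' s x) (at s within {a..})"
    and bound: "\<And>x s. x \<in> space M \<Longrightarrow> a \<le> s \<Longrightarrow> \<bar>q' s x\<bar> \<le> K"
  shows "((\<lambda>s. \<integral>x. q s x \<partial>M) has_real_derivative (\<integral>x. q' t x \<partial>M)) (at t within {a..})"
  unfolding has_field_derivative_iff tendsto_at_iff_sequentially comp_def
proof (intro allI impI)
  interpret finite_measure M by fact
  fix X :: "nat \<Rightarrow> real"
  assume X: "\<forall>i. X i \<in> {a..} - {t}" "X \<longlonglongrightarrow> t"
  define d where "d i x = (q (X i) x - q t x) / (X i - t)" for i x
  have "(\<lambda>i. \<integral>x. d i x \<partial>M) \<longlonglongrightarrow> (\<integral>x. q' t x \<partial>M)"
  proof (rule integral_dominated_convergence)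
    show "integrable M (\<lambda>_. K)" by simp
    show "d i \<in> borel_measurable M" for i
    proof -
      have "integrable M (q (X i))" "integrable M (q t)" using X(1) t q by auto
      then show ?thesis
        unfolding d_def by (intro borel_measurable_divide borel_measurable_diff borel_measurable_const)
          (auto dest: borel_measurable_integrable)
    qed
    show "AE x in M. (\<lambda>i. d i x) \<longlonglongrightarrow> q' t x"
    proof (rule AE_I2)
      fix x assume "x \<in> space M"
      from deriv [OF this t] show "(\<lambda>i. d i x) \<longlonglongrightarrow> q' t x"
        using X unfolding has_field_derivative_iff tendsto_at_iff_sequentially comp_def d_def by blast
    qed
    show "AE x in M. norm (d i x) \<le> K" for i
    proof (rule AE_I2)
      fix x assume x: "x \<in> space M"
      have "norm (q (X i) x - q t x) \<le> K * norm (X i - t)"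
      proof (rule field_differentiable_bound [of "{a..}"])
        show "\<And>s. s \<in> {a..} \<Longrightarrow> ((\<lambda>s. q s x) has_field_derivative q' s x) (at s within {a..})"
          using deriv x by simp
      qed (use X(1) t x bound in auto)
      then show "norm (d i x) \<le> K"
        using X(1) [rule_format, of i] by (simp add: d_def field_simps)
    qed
  qed (fact q')
  also have "(\<lambda>i. \<integral>x. d i x \<partial>M) = (\<lambda>i. ((\<integral>x. q (X i) x \<partial>M) - (\<integral>x. q t x \<partial>M)) / (X i - t))"
    using X(1) t q unfolding d_def by (intro ext) simp
  finally show "(\<lambda>i. ((\<integral>x. q (X i) x \<partial>M) - (\<integral>x. q t x \<partial>M)) / (X i - t)) \<longlonglongrightarrow> (\<integral>x. q' t x \<partial>M)" .
qed

section \<open>Smooth plateau functions from flat exponentials\<close>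

definition flat_exp :: "real poly \<Rightarrow> real \<Rightarrow> real" where
  "flat_exp p x = (if 0 < x then poly p (1 / x) * exp (- 1 / x) else 0)"

lemma tendsto_poly_exp_0: "((\<lambda>y. poly p y * exp (- y)) \<longlongrightarrow> 0) at_top" for p :: "real poly"
proof -
  have "((\<lambda>y. \<Sum>i\<le>degree p. coeff p i * (y ^ i / exp y)) \<longlongrightarrow> (\<Sum>i\<le>degree p. coeff p i * 0)) at_top"
    by (intro tendsto_sum tendsto_mult tendsto_const tendsto_power_div_exp_0)
  then show ?thesis
    by (simp add: poly_altdef exp_minus field_simps sum_divide_distrib)
qed

text \<open>The polynomial factor makes this class closed under differentiation, which yields
  derivatives of every order at once. Away from 0 this is the chain rule with 1/x; at 0 the
  difference quotient is again a flat exponential with one more factor 1/h, and the exponential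
  decay wins.\<close>

lemma has_real_derivative_flat_exp:
  "(flat_exp p has_real_derivative flat_exp ((p - pderiv p) * [:0, 0, 1:]) x) (at x)"
proof (cases x "0 :: real" rule: linorder_cases)
  case less
  have "((\<lambda>_. 0) has_real_derivative 0) (at x)" by simp
  then have "(flat_exp p has_real_derivative 0) (at x)"
    by (rule has_field_derivative_transform_within_open [where S = "{..<0}"])
      (use less in \<open>auto simp: flat_exp_def\<close>)
  then show ?thesis using less by (simp add: flat_exp_def)
next
  case greater
  have "((\<lambda>x. poly p (1 / x) * exp (- 1 / x)) has_real_derivative
      (poly (p - pderiv p) (1 / x)) * (1 / x)\<^sup>2 * exp (- 1 / x)) (at x)"
    using greater
    by (auto intro!: derivative_eq_intros poly_DERIV [THEN DERIV_chain2] simp: field_simps power2_eq_square)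
  then have "(flat_exp p has_real_derivative
      (poly (p - pderiv p) (1 / x)) * (1 / x)\<^sup>2 * exp (- 1 / x)) (at x)"
    by (rule has_field_derivative_transform_within_open [where S = "{0<..}"])
      (use greater in \<open>auto simp: flat_exp_def\<close>)
  then show ?thesis using greater by (simp add: flat_exp_def power2_eq_square algebra_simps)
next
  case equal
  have "((\<lambda>h. flat_exp p h / h) \<longlongrightarrow> 0) (at_right 0)"
  proof -
    have "((\<lambda>h. poly (p * [:0, 1:]) (inverse h) * exp (- inverse h)) \<longlongrightarrow> (0 :: real)) (at_right 0)"
      using filterlim_compose [OF tendsto_poly_exp_0 filterlim_inverse_at_top_right] .
    moreover have "\<forall>\<^sub>F h in at_right (0 :: real).
        poly (p * [:0, 1:]) (inverse h) * exp (- inverse h) = flat_exp p h / h"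
      by (auto simp: eventually_at_filter flat_exp_def field_simps intro!: always_eventually)
    ultimately show ?thesis by (rule Lim_transform_eventually)
  qed
  moreover have "((\<lambda>h. flat_exp p h / h) \<longlongrightarrow> 0) (at_left 0)"
    by (rule tendsto_eventually) (auto simp: eventually_at_filter flat_exp_def intro!: always_eventually)
  ultimately have "((\<lambda>h. flat_exp p h / h) \<longlongrightarrow> 0) (at 0)"
    by (simp add: filterlim_at_split)
  then show ?thesis
    using equal by (simp add: has_field_derivative_iff flat_exp_def)
qed

text \<open>Reduces infinite differentiability to a single derivative that stays in the set.\<close>

lemma iterated_deriv_differentiable:
  assumes S: "\<And>g. g \<in> S \<Longrightarrow> \<exists>g'\<in>S. \<forall>t. (g has_real_derivative g' t) (at t)" and "f \<in> S"
  shows "((deriv ^^ n) f) differentiable (at t)"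
proof -
  have deriv: "deriv g \<in> S \<and> (\<forall>t. g differentiable (at t))" if "g \<in> S" for g
  proof -
    obtain g' where g': "g' \<in> S" "\<And>t. (g has_real_derivative g' t) (at t)" using S \<open>g \<in> S\<close> by blast
    then have "deriv g = g'" by (auto intro: DERIV_imp_deriv)
    with g' show ?thesis by (auto simp: real_differentiable_def)
  qed
  have "(deriv ^^ n) f \<in> S" by (induction n) (use deriv \<open>f \<in> S\<close> in auto)
  with deriv show ?thesis by blast
qed

text \<open>A generator vanishes outside the interval from a to b. Sums are included because the
  product rule turns one generator into two.\<close>

inductive_set bump_sums :: "(real \<Rightarrow> real) set" where
  bump: "(\<lambda>t. c * (flat_exp p (t - a) * flat_exp q (b - t))) \<in> bump_sums"
| add: "f \<in> bump_sums \<Longrightarrow> g \<in> bump_sums \<Longrightarrow> (\<lambda>t. f t + g t) \<in> bump_sums"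

lemma bump_sums_deriv:
  "f \<in> bump_sums \<Longrightarrow> \<exists>f'\<in>bump_sums. \<forall>t. (f has_real_derivative f' t) (at t)"
proof (induction rule: bump_sums.induct)
  case (bump c p a q b)
  define p' where "p' = (p - pderiv p) * [:0, 0, 1:]"
  define q' where "q' = (q - pderiv q) * [:0, 0, 1:]"
  have d: "((\<lambda>t. c * (flat_exp p (t - a) * flat_exp q (b - t))) has_real_derivative
      c * (flat_exp p' (t - a) * flat_exp q (b - t)) + (- c) * (flat_exp p (t - a) * flat_exp q' (b - t)))
      (at t)" for t
    unfolding p'_def q'_def
    by (rule derivative_eq_intros has_real_derivative_flat_exp [THEN DERIV_chain2] refl)+
      (simp add: algebra_simps)
  show ?case
    by (rule bexI [OF _ bump_sums.add [OF bump_sums.bump bump_sums.bump]]) (use d in blast)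
next
  case (add f g)
  then obtain f' g' where "f' \<in> bump_sums" "g' \<in> bump_sums"
    "\<And>t. (f has_real_derivative f' t) (at t)" "\<And>t. (g has_real_derivative g' t) (at t)" by blast
  then show ?case
    by (intro bexI [of _ "\<lambda>t. f' t + g' t"]) (auto intro: bump_sums.add DERIV_add)
qed

text \<open>A smooth multiple of the indicator of the interval from t1 to t2: it rises near t1 and
  falls near t2. The bounds on e keep the support inside t > 0 and the two slopes disjoint.\<close>

lemma plateau_test_function:
  fixes t1 t2 e :: real
  assumes "0 < e" "e < t1" "t1 + e < t2 - e"
  obtains \<eta> where "time_test_function \<eta>" "\<And>t. (\<eta> has_real_derivative deriv \<eta> t) (at t)"
    "continuous_on UNIV (deriv \<eta>)"
    "\<And>t. t \<le> t1 - e \<or> t2 + e \<le> t \<Longrightarrow> \<eta> t = 0"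
    "\<And>t. \<bar>t - t1\<bar> < e \<Longrightarrow> 0 < deriv \<eta> t" "\<And>t. \<bar>t - t2\<bar> < e \<Longrightarrow> deriv \<eta> t < 0"
    "\<And>t. e \<le> \<bar>t - t1\<bar> \<Longrightarrow> e \<le> \<bar>t - t2\<bar> \<Longrightarrow> deriv \<eta> t = 0"
proof -
  define b where "b s t = flat_exp 1 (t - (s - e)) * flat_exp 1 (s + e - t)" for s t
  have b_pos: "0 < b s t" if "\<bar>t - s\<bar> < e" for s t using that by (auto simp: b_def flat_exp_def)
  have b_0: "b s t = 0" if "e \<le> \<bar>t - s\<bar>" for s t using that by (auto simp: b_def flat_exp_def)
  \<comment> \<open>The bumps are translates of one another and so have equal area; hence the
    difference of the shifted antiderivatives returns to 0 beyond t2.\<close>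
  have b_shift: "b s t = b 0 (t - s)" for s t by (simp add: b_def algebra_simps)
  have cont: "isCont (flat_exp p) t" for p t by (rule DERIV_isCont [OF has_real_derivative_flat_exp])
  have cont_b: "isCont (b s) t" for s t
    unfolding b_def by (intro continuous_intros isCont_o2 [OF _ cont])
  obtain B where B: "\<And>t. (B has_real_derivative b 0 t) (at t)"
    using einterval_antiderivative [of "-\<infinity>" \<infinity> "b 0"] cont_b
    by (auto simp: has_real_derivative_iff_has_vector_derivative)
  define \<eta> where "\<eta> t = B (t - t1) - B (t - t2)" for t
  have D: "(\<eta> has_real_derivative b t1 t - b t2 t) (at t)" for t
    unfolding \<eta>_def b_shift [of t1] b_shift [of t2]
    by (rule derivative_eq_intros B [THEN DERIV_chain2] refl)+ simp
  then have d: "deriv \<eta> t = b t1 t - b t2 t" for t by (rule DERIV_imp_deriv)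
  have B_const: "B s = B t" if "s < t" "t \<le> - e \<or> e \<le> s" for s t
  proof -
    have "B t = B s"
    proof (rule DERIV_isconst_end [OF \<open>s < t\<close>])
      show "continuous_on {s..t} B"
        using B by (meson DERIV_isCont continuous_at_imp_continuous_on)
      show "(B has_real_derivative 0) (at x)" if "s < x" "x < t" for x
      proof -
        have "e \<le> \<bar>x - 0\<bar>" using that \<open>t \<le> - e \<or> e \<le> s\<close> by linarith
        then show ?thesis using B [of x] b_0 [of x 0] by simp
      qed
    qed
    then show ?thesis by simp
  qed
  have B_out: "B s = B t" if "(s \<le> - e \<and> t \<le> - e) \<or> (e \<le> s \<and> e \<le> t)" for s t
  proof (cases s t rule: linorder_cases)
    case less
    then show ?thesis by (rule B_const) (use that in blast)
  next
    case greater
    then show ?thesis by (rule B_const [symmetric]) (use that in blast)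
  qed simp
  have \<eta>_0: "\<eta> t = 0" if "t \<le> t1 - e \<or> t2 + e \<le> t" for t
  proof -
    have "B (t - t1) = B (t - t2)" by (rule B_out) (use that assms in linarith)
    then show ?thesis by (simp add: \<eta>_def)
  qed
  show thesis
  proof (rule that)
    have "(\<lambda>t. 1 * (flat_exp 1 (t - (t1 - e)) * flat_exp 1 (t1 + e - t))
        + - 1 * (flat_exp 1 (t - (t2 - e)) * flat_exp 1 (t2 + e - t))) \<in> bump_sums"
      by (intro bump_sums.intros)
    then have b12: "(\<lambda>t. b t1 t - b t2 t) \<in> bump_sums" by (simp add: b_def)
    \<comment> \<open>\<open>\<eta>\<close> is only an antiderivative of a sum of bumps; adjoining
      it keeps the set closed under differentiation.\<close>
    have S: "\<exists>g'\<in>insert \<eta> bump_sums. \<forall>t. (g has_real_derivative g' t) (at t)"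
      if "g \<in> insert \<eta> bump_sums" for g
    proof (cases "g = \<eta>")
      case True
      then show ?thesis using D b12 by (intro bexI [of _ "\<lambda>t. b t1 t - b t2 t"]) auto
    qed (use that bump_sums_deriv in blast)
    show "time_test_function \<eta>"
      unfolding time_test_function_def
    proof (intro conjI allI exI)
      show "(deriv ^^ n) \<eta> differentiable at t" for n t
        using iterated_deriv_differentiable [of "insert \<eta> bump_sums" \<eta> n t, OF S] by simp
      show "0 < t1 - e" using assms by simp
      show "\<eta> t \<noteq> 0 \<longrightarrow> t1 - e \<le> t \<and> t \<le> t2 + e" for t using \<eta>_0 [of t] by linarith
    qed
    show "continuous_on UNIV (deriv \<eta>)"
      unfolding d using cont_b by (simp add: continuous_at_imp_continuous_on)
    show "(\<eta> has_real_derivative deriv \<eta> t) (at t)" for t using D d by simp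
    show "0 < deriv \<eta> t" if "\<bar>t - t1\<bar> < e" for t
      proof -
      have "e \<le> \<bar>t - t2\<bar>" using that assms by linarith
      then show ?thesis using b_pos [OF that] b_0 [of t t2] unfolding d by simp
    qed
    show "deriv \<eta> t < 0" if "\<bar>t - t2\<bar> < e" for t
      proof -
      have "e \<le> \<bar>t - t1\<bar>" using that assms by linarith
      then show ?thesis using b_pos [OF that] b_0 [of t t1] unfolding d by simp
    qed
    show "deriv \<eta> t = 0" if "e \<le> \<bar>t - t1\<bar>" "e \<le> \<bar>t - t2\<bar>" for t
      using that b_0 unfolding d by simp
  qed (use \<eta>_0 in auto)
qed

section \<open>From distributional to classical derivatives in time\<close>

lemma LBINT_Ioi_eq_integral:
  fixes f :: "real \<Rightarrow> real"
  assumes "continuous_on {a..b} f" "0 < a" "\<And>t. t \<notin> {a..b} \<Longrightarrow> f t = 0"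
  shows "(LBINT t:{0<..}. f t) = integral {a..b} f"
proof -
  have "set_integrable lborel {a..b} f"
    using assms(1) by (intro borel_integrable_atLeastAtMost') 
  then have "(LBINT t:{a..b}. f t) = integral {a..b} f"
    by (rule set_borel_integral_eq_integral)
  moreover have "(LBINT t:{0<..}. f t) = (LBINT t:{a..b}. f t)"
    unfolding set_lebesgue_integral_def
    by (intro Bochner_Integration.integral_cong refl) (use assms in \<open>auto simp: indicator_def\<close>)
  ultimately show ?thesis by simp
qed

text \<open>If m minus the primitive of g, called h, rose from t1 to t2, pick a level c in between.
  The weak equation, tested with a plateau function, says that
  \<open>deriv \<eta> t * (c - h t)\<close> integrates to 0, yet this product is nonnegative
  everywhere and positive at t1.\<close>

lemma weak_derivative_nonincreasing:
  fixes m g :: "real \<Rightarrow> real"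
  assumes m: "continuous_on {0..} m" and g: "continuous_on {0..} g"
    and weak: "\<And>\<eta>. time_test_function \<eta> \<Longrightarrow>
      - (LBINT t:{0<..}. deriv \<eta> t * m t) = (LBINT t:{0<..}. \<eta> t * g t)"
    and t: "0 < t1" "t1 < t2"
  shows "m t2 - integral {0..t2} g \<le> m t1 - integral {0..t1} g"
proof (rule ccontr)
  define G where "G t = integral {0..t} g" for t
  define h where "h t = m t - G t" for t
  assume "\<not> ?thesis"
  then obtain c where c: "h t1 < c" "c < h t2"
    using dense [of "h t1" "h t2"] by (auto simp: h_def G_def)
  have G: "(G has_real_derivative g t) (at t within {0..})" if "0 \<le> t" for t
    unfolding G_def by (rule has_real_derivative_integral [OF g that])
  have contG: "continuous_on {0..} G"
    using G by (meson DERIV_continuous atLeast_iff continuous_on_eq_continuous_within)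
  then have conth: "continuous_on {0..} h"
    unfolding h_def by (intro continuous_intros m)
  have isCont: "isCont h t" if "0 < t" for t
    using continuous_on_interior [OF conth, of t] that by simp
  obtain e1 where e1: "0 < e1" "\<And>t. \<bar>t - t1\<bar> < e1 \<Longrightarrow> h t < c"
    using order_tendstoD(2) [OF isCont [unfolded isCont_def, OF t(1)] c(1)] c(1)
    unfolding eventually_at by (auto simp: dist_real_def) metis
  obtain e2 where e2: "0 < e2" "\<And>t. \<bar>t - t2\<bar> < e2 \<Longrightarrow> c < h t"
    using order_tendstoD(1) [OF isCont [unfolded isCont_def, of t2] c(2)] c(2) t
    unfolding eventually_at by (auto simp: dist_real_def) metis
  \<comment> \<open>Small enough that h stays on its side of c on both slopes, that the support
    stays in t > 0 and that the slopes do not overlap.\<close>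
  define e where "e = min (min e1 e2) (min (t1 / 2) ((t2 - t1) / 3))"
  have e: "0 < e" "e \<le> e1" "e \<le> e2" "e < t1" "t1 + e < t2 - e"
  proof -
    have "0 < e" using e1(1) e2(1) t by (simp add: e_def)
    moreover have "e \<le> e1" "e \<le> e2" "e \<le> t1 / 2" "e \<le> (t2 - t1) / 3"
      unfolding e_def by (meson min.cobounded1 min.cobounded2 order_trans)+
    ultimately show "0 < e" "e \<le> e1" "e \<le> e2" "e < t1" "t1 + e < t2 - e"
      using t by (simp_all add: field_simps)
  qed
  obtain \<eta> where \<eta>: "time_test_function \<eta>" "\<And>t. (\<eta> has_real_derivative deriv \<eta> t) (at t)"
    "continuous_on UNIV (deriv \<eta>)"
    "\<And>t. t \<le> t1 - e \<or> t2 + e \<le> t \<Longrightarrow> \<eta> t = 0"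
    "\<And>t. \<bar>t - t1\<bar> < e \<Longrightarrow> 0 < deriv \<eta> t" "\<And>t. \<bar>t - t2\<bar> < e \<Longrightarrow> deriv \<eta> t < 0"
    "\<And>t. e \<le> \<bar>t - t1\<bar> \<Longrightarrow> e \<le> \<bar>t - t2\<bar> \<Longrightarrow> deriv \<eta> t = 0"
    using plateau_test_function [OF e(1,4,5)] by blast
  define a b where "a = t1 - e" and "b = t2 + e"
  have ab: "0 < a" "a \<le> b" "{a..b} \<subseteq> {0..}" using e t by (auto simp: a_def b_def)
  note cont = continuous_on_subset [OF m ab(3)] continuous_on_subset [OF g ab(3)]
    continuous_on_subset [OF contG ab(3)] continuous_on_subset [OF conth ab(3)]
  have cd: "continuous_on {a..b} (deriv \<eta>)" using \<eta>(3) by (rule continuous_on_subset) simp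
  have c\<eta>: "continuous_on {a..b} \<eta>"
    using \<eta>(2) by (meson DERIV_isCont continuous_at_imp_continuous_on)
  have d0: "deriv \<eta> t = 0" if "t \<notin> {a..b}" for t
    by (rule \<eta>(7)) (use that e in \<open>auto simp: a_def b_def abs_if\<close>)
  have \<eta>0: "\<eta> t = 0" if "t \<notin> {a<..<b}" for t
    by (rule \<eta>(4)) (use that in \<open>auto simp: a_def b_def\<close>)
  have "- integral {a..b} (\<lambda>t. deriv \<eta> t * m t) = integral {a..b} (\<lambda>t. \<eta> t * g t)"
  proof -
    have "(LBINT t:{0<..}. deriv \<eta> t * m t) = integral {a..b} (\<lambda>t. deriv \<eta> t * m t)"
      using d0 ab(1) by (intro LBINT_Ioi_eq_integral continuous_intros cd cont) auto
    moreover have "(LBINT t:{0<..}. \<eta> t * g t) = integral {a..b} (\<lambda>t. \<eta> t * g t)"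
      using \<eta>0 ab(1) by (intro LBINT_Ioi_eq_integral continuous_intros c\<eta> cont) auto
    ultimately show ?thesis using weak [OF \<eta>(1)] by simp
  qed
  \<comment> \<open>Integration by parts for G; the constant c may be added since
    \<open>\<eta>\<close> vanishes at both ends.\<close>
  moreover have "((\<lambda>t. deriv \<eta> t * (G t + c) + \<eta> t * g t) has_integral
      \<eta> b * (G b + c) - \<eta> a * (G a + c)) {a..b}"
  proof (rule fundamental_theorem_of_calculus [OF ab(2)])
    fix t assume "t \<in> {a..b}"
    then have "(G has_real_derivative g t) (at t within {a..b})"
      using ab(1) by (intro DERIV_subset [OF G ab(3)]) simp
    then show "((\<lambda>t. \<eta> t * (G t + c)) has_vector_derivative deriv \<eta> t * (G t + c) + \<eta> t * g t)
        (at t within {a..b})"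
      unfolding has_real_derivative_iff_has_vector_derivative [symmetric]
      by (auto intro!: derivative_eq_intros has_field_derivative_at_within [OF \<eta>(2)])
  qed
  then have "integral {a..b} (\<lambda>t. deriv \<eta> t * (G t + c) + \<eta> t * g t) = 0"
    using \<eta>(4) by (simp add: a_def b_def integral_unique)
  then have "integral {a..b} (\<lambda>t. deriv \<eta> t * (G t + c)) + integral {a..b} (\<lambda>t. \<eta> t * g t) = 0"
    by (subst (asm) integral_add)
      (auto intro!: integrable_continuous_real continuous_intros cd c\<eta> cont)
  ultimately have "integral {a..b} (\<lambda>t. deriv \<eta> t * (G t + c)) - integral {a..b} (\<lambda>t. deriv \<eta> t * m t) = 0"
    by linarith
  then have "integral {a..b} (\<lambda>t. deriv \<eta> t * (G t + c) - deriv \<eta> t * m t) = 0"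
    by (subst integral_diff)
      (auto intro!: integrable_continuous_real continuous_intros cd c\<eta> cont)
  then have "integral {a..b} (\<lambda>t. deriv \<eta> t * (c - h t)) = 0"
    by (simp add: h_def algebra_simps)
  moreover have "0 \<le> deriv \<eta> t * (c - h t)" for t
  proof -
    consider "\<bar>t - t1\<bar> < e" | "\<bar>t - t2\<bar> < e" | "e \<le> \<bar>t - t1\<bar>" "e \<le> \<bar>t - t2\<bar>" by linarith
    then show ?thesis
    proof cases
      case 1
      then show ?thesis using \<eta>(5) [of t] e1(2) [of t] e by simp
    next
      case 2
      then show ?thesis using \<eta>(6) [of t] e2(2) [of t] e by (simp add: mult_nonpos_nonpos)
    qed (simp add: \<eta>(7))
  qed
  moreover have "continuous_on {a..b} (\<lambda>t. deriv \<eta> t * (c - h t))"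
    by (intro continuous_intros cd cont)
  ultimately have "\<forall>t\<in>{a..b}. deriv \<eta> t * (c - h t) = 0"
    using integral_eq_0_iff [of a b "\<lambda>t. deriv \<eta> t * (c - h t)"] e t by (simp add: a_def b_def)
  then have "deriv \<eta> t1 * (c - h t1) = 0" using e t by (simp add: a_def b_def)
  then show False using \<eta>(5) [of t1] e(1) c(1) by simp
qed

text \<open>The du Bois-Reymond lemma: m minus the integral of g is constant for t > 0, by the
  previous estimate for m and for -m. Continuity carries the constant to t = 0, so that the initial
  value is reached with a one-sided derivative.\<close>

lemma has_real_derivative_of_weak_derivative:
  fixes m g :: "real \<Rightarrow> real"
  assumes m: "continuous_on {0..} m" and g: "continuous_on {0..} g"
    and weak: "\<And>\<eta>. time_test_function \<eta> \<Longrightarrow>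
      - (LBINT t:{0<..}. deriv \<eta> t * m t) = (LBINT t:{0<..}. \<eta> t * g t)"
    and "0 \<le> t"
  shows "(m has_real_derivative g t) (at t within {0..})"
proof -
  define h where "h t = m t - integral {0..t} g" for t
  have "h t1 = h t2" if "0 < t1" "t1 < t2" for t1 t2
  proof (rule antisym)
    show "h t2 \<le> h t1"
      unfolding h_def by (rule weak_derivative_nonincreasing [OF m g weak that])
    have "- (LBINT t:{0<..}. deriv \<eta> t * - m t) = (LBINT t:{0<..}. \<eta> t * - g t)"
      if "time_test_function \<eta>" for \<eta>
      using weak [OF that] by (simp add: set_lebesgue_integral_def)
    then show "h t1 \<le> h t2"
      using weak_derivative_nonincreasing [OF continuous_on_minus [OF m] continuous_on_minus [OF g] _ that]
      by (simp add: h_def)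
  qed
  note const_pos = this
  have pos: "h s = h 1" if "0 < s" for s
  proof (cases s "1 :: real" rule: linorder_cases)
    case less
    then show ?thesis by (rule const_pos [OF that])
  next
    case greater
    then show ?thesis by (intro const_pos [symmetric]) simp_all
  qed simp
  have dG: "((\<lambda>t. integral {0..t} g) has_real_derivative g t) (at t within {0..})" if "0 \<le> t" for t
    by (rule has_real_derivative_integral [OF g that])
  have "continuous_on {0..} (\<lambda>t. integral {0..t} g)"
    using dG by (meson DERIV_continuous atLeast_iff continuous_on_eq_continuous_within)
  then have conth: "continuous_on {0..} h" unfolding h_def by (intro continuous_intros m)
  have const: "h s = h 1" if "0 \<le> s" for s
  proof (rule continuous_constant_on_closure [of "{0<..}" h])
    show "continuous_on (closure {0<..}) h" using conth by simp
    show "h x = h 1" if "x \<in> {0<..}" for x by (rule pos) (use that in simp)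
    show "s \<in> closure {0<..}" using \<open>0 \<le> s\<close> by simp
  qed
  have "((\<lambda>t. h 1 + integral {0..t} g) has_real_derivative g t) (at t within {0..})"
    using dG [OF \<open>0 \<le> t\<close>] by (auto intro!: derivative_eq_intros)
  moreover have "m s = h 1 + integral {0..s} g" if "s \<in> {0..}" for s
    using const [of s, symmetric] that by (simp add: h_def)
  ultimately show ?thesis
    using \<open>0 \<le> t\<close> by (auto elim!: has_field_derivative_transform_within [where d = 1])
qed

section \<open>Moments and their hierarchy\<close>

text \<open>For lists in \<open>Basis\<close> these are the monomials in the real coordinates:
  concatenation is multiplication, length is degree.\<close>

definition word :: "'a::real_inner list \<Rightarrow> 'a \<Rightarrow> real" where
  "word bs x = (\<Prod>b\<leftarrow>bs. x \<bullet> b)"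

lemma word_simps [simp]:
  "word [] x = 1" "word (b # bs) x = (x \<bullet> b) * word bs x" "word (as @ bs) x = word as x * word bs x"
  by (simp_all add: word_def)

text \<open>Values are bounded linear maps because \<open>C1_unitary\<close> asks for a derivative
  that is continuous in operator norm.\<close>

fun word_derivative :: "'a::real_inner list \<Rightarrow> 'a \<Rightarrow> 'a \<Rightarrow>\<^sub>L real" where
  "word_derivative [] x = 0"
| "word_derivative (b # bs) x = (x \<bullet> b) *\<^sub>R word_derivative bs x + word bs x *\<^sub>R blinfun_inner_left b"

lemma has_derivative_word:
  "(word bs has_derivative blinfun_apply (word_derivative bs x)) (at x within S)"
proof (induction bs)
  case Nil
  have "word [] = (\<lambda>x. 1)" by (rule ext) simp
  then show ?case by (simp add: zero_blinfun.rep_eq)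
next
  case (Cons b bs)
  have "word (b # bs) = (\<lambda>x. (x \<bullet> b) * word bs x)" by (rule ext) simp
  then show ?case
    by (auto intro!: derivative_eq_intros Cons simp: blinfun.bilinear_simps)
qed

lemma continuous_on_word [continuous_intros]: "continuous_on S (word bs)"
  using has_derivative_word by (intro has_derivative_continuous_on)

lemma continuous_on_word_derivative [continuous_intros]: "continuous_on S (word_derivative bs)"
proof (induction bs)
  case Nil
  have "word_derivative [] = (\<lambda>x. 0)" by (rule ext) simp
  then show ?case by simp
next
  case (Cons b bs)
  have "word_derivative (b # bs)
      = (\<lambda>x. (x \<bullet> b) *\<^sub>R word_derivative bs x + word bs x *\<^sub>R blinfun_inner_left b)"
    by (rule ext) simp
  then show ?case by (auto intro!: continuous_intros Cons)
qed

lemma continuous_on_word_derivative_apply [continuous_intros]: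
  fixes f g :: "'a::topological_space \<Rightarrow> 'b::euclidean_space"
  assumes "continuous_on S f" "continuous_on S g"
  shows "continuous_on S (\<lambda>x. word_derivative bs (f x) (g x))"
  using assms
  by (intro continuous_intros continuous_on_compose2 [OF continuous_on_word_derivative, where t = UNIV]) auto

lemma C1_unitary_word: "C1_unitary (word bs :: complex^'d^'d \<Rightarrow> real)"
  unfolding C1_unitary_def
proof
  fix U :: "complex^'d^'d"
  show "\<exists>N \<Phi>. \<exists>\<Phi>' :: complex^'d^'d \<Rightarrow> (complex^'d^'d) \<Rightarrow>\<^sub>L real.
        open N \<and> U \<in> N \<and> (\<forall>A\<in>N. (\<Phi> has_derivative blinfun_apply (\<Phi>' A)) (at A)) \<and>
        continuous_on N \<Phi>' \<and> (\<forall>A\<in>N \<inter> unitary_group. \<Phi> A = word bs A)"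
    by (rule exI [of _ UNIV], rule exI [of _ "word bs"], rule exI [of _ "word_derivative bs"])
      (simp add: has_derivative_word continuous_on_word_derivative)
qed

lemma abs_word_le:
  assumes "norm x \<le> R" "0 \<le> R" "set bs \<subseteq> Basis"
  shows "\<bar>word bs x\<bar> \<le> R ^ length bs"
  using assms(3)
proof (induction bs)
  case (Cons b bs)
  have "\<bar>x \<bullet> b\<bar> \<le> R" using Cons.prems assms(1) Basis_le_norm [of b x] by simp
  with Cons show ?case by (auto simp: abs_mult intro!: mult_mono \<open>0 \<le> R\<close>)
qed simp

text \<open>Each coordinate of the quadratic part of \<open>riccati\<close> becomes a combination of
  words of length two. Replacing one letter by two is what raises the degree by one.\<close>

lemma matrix_mult_expand:
  fixes U A :: "complex^'d^'d"
  shows "U ** A ** U = (\<Sum>c\<in>Basis. \<Sum>e\<in>Basis. ((U \<bullet> c) * (U \<bullet> e)) *\<^sub>R (c ** A ** e))"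
proof -
  note bl = bounded_bilinear_matrix_matrix_mult
  have "U ** A ** U = (\<Sum>c\<in>Basis. (U \<bullet> c) *\<^sub>R c) ** A ** (\<Sum>e\<in>Basis. (U \<bullet> e) *\<^sub>R e)"
    by (simp add: euclidean_representation)
  also have "\<dots> = (\<Sum>c\<in>Basis. \<Sum>e\<in>Basis. ((U \<bullet> c) * (U \<bullet> e)) *\<^sub>R (c ** A ** e))"
    by (simp add: bounded_bilinear.sum_left [OF bl] bounded_bilinear.sum_right [OF bl]
        bounded_bilinear.scaleR_left [OF bl] bounded_bilinear.scaleR_right [OF bl] scaleR_sum_right mult.commute)
      (subst sum.swap, simp add: mult.commute)
  finally show ?thesis .
qed

text \<open>Linearity is required on continuous functions only: elsewhere the integrals to be
  inserted may fail to converge and then take the default value 0, which is not additive. The name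
  refers to the domain, not to boundedness.\<close>

locale continuous_functional =
  fixes \<Lambda> :: "('a::euclidean_space \<Rightarrow> real) \<Rightarrow> real"
  assumes additive: "continuous_on UNIV p \<Longrightarrow> continuous_on UNIV q \<Longrightarrow> \<Lambda> (\<lambda>x. p x + q x) = \<Lambda> p + \<Lambda> q"
    and homogeneous: "continuous_on UNIV p \<Longrightarrow> \<Lambda> (\<lambda>x. c * p x) = c * \<Lambda> p"
begin

lemma zero: "\<Lambda> (\<lambda>x. 0) = 0"
  using homogeneous [of "\<lambda>_. 0" 0] by simp

lemma sum:
  assumes "finite I" "\<And>i. i \<in> I \<Longrightarrow> continuous_on UNIV (p i)"
  shows "\<Lambda> (\<lambda>x. \<Sum>i\<in>I. p i x) = (\<Sum>i\<in>I. \<Lambda> (p i))"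
  using assms by (induction I) (simp_all add: zero additive continuous_on_sum)

text \<open>The factors r and w are what the induction needs: a linear polynomial lengthens w by a
  coordinate, a product moves its second factor into r.\<close>

lemma mult_real_polynomial_eq_0:
  assumes "real_polynomial_function p" "continuous_on UNIV r"
    and "\<And>w. set w \<subseteq> Basis \<Longrightarrow> \<Lambda> (\<lambda>x. r x * word w x) = 0"
    and "set w \<subseteq> Basis"
  shows "\<Lambda> (\<lambda>x. p x * r x * word w x) = 0"
  using assms
proof (induction arbitrary: r w rule: real_polynomial_function.induct)
  case (linear f)
  have f: "f x = (\<Sum>b\<in>Basis. f b * (x \<bullet> b))" for x
  proof -
    have "f x = f (\<Sum>b\<in>Basis. (x \<bullet> b) *\<^sub>R b)" by (simp add: euclidean_representation)
    then show ?thesis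
      using linear.hyps by (simp add: linear_simps real_vector.linear_sum bounded_linear.linear mult.commute
          linear_sum linear_cmul)
  qed
  have "(\<lambda>x. f x * r x * word w x) = (\<lambda>x. \<Sum>b\<in>Basis. f b * (r x * word (b # w) x))"
    by (rule ext, subst f) (simp add: sum_distrib_left mult_ac)
  moreover have "\<Lambda> \<dots> = (\<Sum>b\<in>Basis. f b * \<Lambda> (\<lambda>x. r x * word (b # w) x))"
    using linear.prems(1) by (subst sum) (auto simp del: word_simps intro!: sum.cong homogeneous continuous_intros)
  moreover have "\<Lambda> (\<lambda>x. r x * word (b # w) x) = 0" if "b \<in> Basis" for b
    by (rule linear.prems(2)) (use linear.prems(3) that in simp)
  ultimately show ?case by (simp del: word_simps)
next
  case (const c)
  have "\<Lambda> (\<lambda>x. c * (r x * word w x)) = c * \<Lambda> (\<lambda>x. r x * word w x)"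
    using const.prems(1) by (intro homogeneous continuous_intros)
  then show ?case using const.prems by (simp add: mult.assoc)
next
  case (add f g)
  have "continuous_on UNIV f" "continuous_on UNIV g"
    using add.hyps by (auto intro: continuous_on_polymonial_function simp: real_polynomial_function_eq)
  then have "\<Lambda> (\<lambda>x. f x * r x * word w x + g x * r x * word w x)
      = \<Lambda> (\<lambda>x. f x * r x * word w x) + \<Lambda> (\<lambda>x. g x * r x * word w x)"
    using add.prems(1) by (intro additive continuous_intros)
  then show ?case using add by (simp add: distrib_right)
next
  case (mult f g)
  have "continuous_on UNIV g"
    using mult.hyps by (auto intro: continuous_on_polymonial_function simp: real_polynomial_function_eq)
  then have "\<Lambda> (\<lambda>x. f x * (g x * r x) * word w x) = 0"
    using mult by (intro mult.IH(1) continuous_intros) auto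
  then show ?case by (simp add: mult_ac)
qed

lemma eq_0_of_words:
  assumes words: "\<And>w. set w \<subseteq> Basis \<Longrightarrow> \<Lambda> (word w) = 0"
    and bound: "\<And>p e. continuous_on UNIV p \<Longrightarrow> (\<And>x. x \<in> S \<Longrightarrow> \<bar>p x\<bar> \<le> e) \<Longrightarrow> \<bar>\<Lambda> p\<bar> \<le> K * e"
    and "compact S" "0 \<le> K" and f: "continuous_on UNIV f"
  shows "\<Lambda> f = 0"
proof -
  have "\<bar>\<Lambda> f\<bar> \<le> e" if "0 < e" for e
  proof -
    \<comment> \<open>The denominator K + 1 also covers K = 0.\<close>
    have "0 < e / (K + 1)" using that \<open>0 \<le> K\<close> by simp
    then obtain g where g: "real_polynomial_function g" "\<And>x. x \<in> S \<Longrightarrow> \<bar>f x - g x\<bar> < e / (K + 1)"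
      using Stone_Weierstrass_real_polynomial_function [of S f] \<open>compact S\<close> f
      by (metis continuous_on_subset subset_UNIV)
    have g0: "\<Lambda> g = 0"
      using mult_real_polynomial_eq_0 [OF g(1), of "\<lambda>_. 1" "[]"] words by simp
    have cg: "continuous_on UNIV g"
      using g(1) by (auto intro: continuous_on_polymonial_function simp: real_polynomial_function_eq)
    have "\<Lambda> f = \<Lambda> (\<lambda>x. (f x - g x) + g x)" by simp
    also have "\<dots> = \<Lambda> (\<lambda>x. f x - g x)"
      using f cg g0 by (subst additive) (auto intro!: continuous_intros)
    finally have "\<bar>\<Lambda> f\<bar> \<le> K * (e / (K + 1))"
      using bound [of "\<lambda>x. f x - g x" "e / (K + 1)"] f cg g(2) by (force intro: continuous_intros less_imp_le)
    also have "\<dots> \<le> e" using that \<open>0 \<le> K\<close> by (simp add: field_simps)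
    finally show ?thesis .
  qed
  then show ?thesis using field_le_epsilon [of "\<bar>\<Lambda> f\<bar>" 0] by simp
qed

end

text \<open>By the Leibniz rule each letter of w is replaced by a coordinate of
  \<open>riccati M U\<close>: a constant term and, with N the real dimension, N^2 words of length
  two, all with coefficients at most R. This gives R (1 + N^2) per letter; u collects the letters
  that the recursion has passed.\<close>

lemma functional_word_derivative_riccati_le:
  fixes \<Lambda> :: "(complex^'d^'d \<Rightarrow> real) \<Rightarrow> real" and M :: "complex^'d^'d"
  assumes "continuous_functional \<Lambda>" and M: "norm M \<le> R"
    and "set u \<subseteq> Basis" "set w \<subseteq> Basis"
    and "\<And>v. set v \<subseteq> Basis \<Longrightarrow> length v \<le> Suc (length u + length w) \<Longrightarrow> \<bar>\<Lambda> (word v)\<bar> \<le> B"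
  shows "\<bar>\<Lambda> (\<lambda>U. word u U * word_derivative w U (riccati M U))\<bar>
    \<le> real (length w) * (R * (1 + (real DIM(complex^'d^'d))\<^sup>2)) * B"
  using assms(3-)
proof (induction w arbitrary: u)
  case Nil
  interpret continuous_functional \<Lambda> by fact
  show ?case by (simp add: zero)
next
  case (Cons b w)
  interpret continuous_functional \<Lambda> by fact
  let ?N = "real DIM(complex^'d^'d)"
  have b: "b \<in> Basis" "norm b = 1" using Cons.prems by auto
  have R: "0 \<le> R" using M norm_ge_zero order_trans by blast
  have B: "\<bar>\<Lambda> (word v)\<bar> \<le> B" if "set v \<subseteq> Basis" "length v \<le> Suc (Suc (length u + length w))" for v
    using Cons.prems(3) [of v] that by simp
  have B0: "0 \<le> B" using B [of "[]"] by simp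
  define k where "k c e = - ((c ** cadjoint M ** e) \<bullet> b)" for c e
  have k: "\<bar>k c e\<bar> \<le> R" if "c \<in> Basis" "e \<in> Basis" for c e
  proof -
    have "\<bar>k c e\<bar> \<le> norm (c ** cadjoint M ** e)"
      using Cauchy_Schwarz_ineq2 [of "c ** cadjoint M ** e" b] b by (simp add: k_def)
    also have "\<dots> \<le> norm c * norm (cadjoint M) * norm e"
      by (meson norm_matrix_matrix_mult_le mult_right_mono norm_ge_zero order_trans)
    finally show ?thesis using that M by simp
  qed
  have expand: "word u U * word_derivative (b # w) U (riccati M U)
      = word (u @ [b]) U * word_derivative w U (riccati M U)
        + ((M \<bullet> b) * word (u @ w) U + (\<Sum>c\<in>Basis. \<Sum>e\<in>Basis. k c e * word (c # e # u @ w) U))" for U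
  proof -
    have "riccati M U \<bullet> b = (M \<bullet> b) + (\<Sum>c\<in>Basis. \<Sum>e\<in>Basis. (U \<bullet> c) * (U \<bullet> e) * k c e)"
      unfolding riccati_def matrix_mult_expand k_def
      by (simp add: inner_diff_left inner_sum_left sum_negf)
    then show ?thesis
      by (simp add: blinfun.bilinear_simps algebra_simps sum_distrib_left sum_distrib_right)
  qed
  have c1: "continuous_on UNIV (\<lambda>U. word (u @ [b]) U * word_derivative w U (riccati M U))"
    and c2: "continuous_on UNIV (\<lambda>U. (M \<bullet> b) * word (u @ w) U)"
    and c3: "continuous_on UNIV (\<lambda>U. \<Sum>c\<in>Basis. \<Sum>e\<in>Basis. k c e * word (c # e # u @ w) U)"
    by (intro continuous_intros)+
  have "\<bar>\<Lambda> (\<lambda>U. word (u @ [b]) U * word_derivative w U (riccati M U))\<bar> \<le> real (length w) * (R * (1 + ?N\<^sup>2)) * B"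
    using Cons.prems B by (intro Cons.IH) auto
  moreover have "\<bar>\<Lambda> (\<lambda>U. (M \<bullet> b) * word (u @ w) U)\<bar> \<le> R * B"
  proof -
    have "\<bar>M \<bullet> b\<bar> \<le> R" using Basis_le_norm [OF b(1), of M] M by simp
    moreover have "\<bar>\<Lambda> (word (u @ w))\<bar> \<le> B" by (rule B) (use Cons.prems in auto)
    ultimately have "\<bar>M \<bullet> b\<bar> * \<bar>\<Lambda> (word (u @ w))\<bar> \<le> R * B" using R by (intro mult_mono) auto
    moreover have "\<Lambda> (\<lambda>U. (M \<bullet> b) * word (u @ w) U) = (M \<bullet> b) * \<Lambda> (word (u @ w))"
      by (intro homogeneous continuous_intros)
    ultimately show ?thesis by (simp only: abs_mult)
  qed
  moreover have "\<bar>\<Lambda> (\<lambda>U. \<Sum>c\<in>Basis. \<Sum>e\<in>Basis. k c e * word (c # e # u @ w) U)\<bar> \<le> ?N\<^sup>2 * (R * B)"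
  proof -
    have "\<Lambda> (\<lambda>U. \<Sum>c\<in>Basis. \<Sum>e\<in>Basis. k c e * word (c # e # u @ w) U)
        = (\<Sum>c\<in>Basis. \<Sum>e\<in>Basis. k c e * \<Lambda> (word (c # e # u @ w)))"
      by (subst sum, simp, intro continuous_intros, subst sum, simp, intro continuous_intros,
          subst homogeneous, intro continuous_intros, rule refl)
    also have "\<bar>\<dots>\<bar> \<le> (\<Sum>c\<in>(Basis :: (complex^'d^'d) set). \<Sum>e\<in>(Basis :: (complex^'d^'d) set). R * B)"
    proof (intro order_trans [OF sum_abs] sum_mono)
      fix c e :: "complex^'d^'d" assume "c \<in> Basis" "e \<in> Basis"
      then show "\<bar>k c e * \<Lambda> (word (c # e # u @ w))\<bar> \<le> R * B"
        unfolding abs_mult using Cons.prems by (intro mult_mono k B R) auto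
    qed
    finally show ?thesis by (simp add: power2_eq_square mult.assoc)
  qed
  ultimately show ?case
    unfolding expand using c1 c2 c3
    by (simp add: additive continuous_on_add algebra_simps)
qed

text \<open>Iterating the derivative bound \<open>n\<close> times gives \<open>(C t)\<^sup>n / n!\<close> against a growth \<open>k (k + 1) \<dots> (k + n - 1)\<close>
  of the word lengths, so that smallness is only obtained on time steps of a fixed length.\<close>

lemma hierarchy_eq_0:
  fixes s s' :: "'a list \<Rightarrow> real \<Rightarrow> real"
  assumes deriv: "\<And>w t. set w \<subseteq> A \<Longrightarrow> 0 \<le> t \<Longrightarrow> (s w has_real_derivative s' w t) (at t within {0..})"
    and bound: "\<And>w t. set w \<subseteq> A \<Longrightarrow> 0 \<le> t \<Longrightarrow> \<bar>s w t\<bar> \<le> K * R ^ length w"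
    and step: "\<And>w t B. set w \<subseteq> A \<Longrightarrow> 0 \<le> t \<Longrightarrow>
      (\<And>v. set v \<subseteq> A \<Longrightarrow> length v \<le> Suc (length w) \<Longrightarrow> \<bar>s v t\<bar> \<le> B) \<Longrightarrow>
      \<bar>s' w t\<bar> \<le> real (length w) * C * B"
    and init: "\<And>w. set w \<subseteq> A \<Longrightarrow> s w 0 = 0"
    and R: "1 \<le> R" and C: "0 \<le> C" and K: "0 \<le> K"
    and "set w \<subseteq> A" "0 \<le> t"
  shows "s w t = 0"
proof -
  \<comment> \<open>Chosen so that 2 R C \<open>\<delta>\<close> \<le> 1/2, where the 2 comes from
    bounding the binomials by \<open>2 ^ (k + n)\<close>; the 1 added to C avoids division by
    0.\<close>
  define \<delta> where "\<delta> = 1 / (4 * (C + 1) * R)"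
  have \<delta>: "0 < \<delta>" using R C by (simp add: \<delta>_def)
  \<comment> \<open>The binomial coefficient combines the growth of the word lengths with the 1/n!
    from n integrations. Words of length at most k are treated together because \<open>step\<close>
    involves all words up to the next length.\<close>
  have est: "\<bar>s w t\<bar> \<le> K * R ^ (k + n) * C ^ n * real ((k + n) choose n) * (t - t0) ^ n"
    if "0 \<le> t0" and zero: "\<And>w. set w \<subseteq> A \<Longrightarrow> s w t0 = 0"
      and "set w \<subseteq> A" "length w \<le> k" "t0 \<le> t" for t0 w k n t
    using that(3-)
  proof (induction n arbitrary: w k t)
    case 0
    have "K * R ^ length w \<le> K * R ^ k" using 0 K R by (intro mult_left_mono power_increasing) auto
    then show ?case using bound [of w t] 0 \<open>0 \<le> t0\<close> by simp
  next
    case (Suc n)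
    define E where "E = K * R ^ (k + Suc n) * C ^ Suc n * real ((k + Suc n) choose Suc n)"
    define g where "g u = E * (u - t0) ^ Suc n" for u
    define g' where "g' u = E * (real (Suc n) * (u - t0) ^ n)" for u
    have dg: "(g has_real_derivative g' u) (at u within {0..})" for u
      unfolding g_def g'_def by (auto intro!: derivative_eq_intros simp del: power_Suc)
    have s': "\<bar>s' w u\<bar> \<le> g' u" if "t0 \<le> u" for u
    proof -
      define F where "F = K * R ^ (k + Suc n) * C ^ n * (u - t0) ^ n"
      have F: "0 \<le> F" using K R C that by (simp add: F_def)
      have "\<bar>s v u\<bar> \<le> F * real ((Suc k + n) choose n)"
        if "set v \<subseteq> A" "length v \<le> Suc (length w)" for v
        using Suc.IH [of v "Suc k" u] that Suc.prems \<open>t0 \<le> u\<close> by (simp add: F_def mult_ac)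
      then have "\<bar>s' w u\<bar> \<le> real (length w) * C * (F * real ((Suc k + n) choose n))"
        using Suc.prems(1) \<open>0 \<le> t0\<close> that by (intro step) auto
      also have "\<dots> = (C * F) * (real (length w) * real ((Suc k + n) choose n))" by simp
      also have "\<dots> \<le> (C * F) * (real (Suc k) * real ((Suc k + n) choose n))"
        using Suc.prems(2) C F by (intro mult_left_mono mult_right_mono) auto
      \<comment> \<open>Rounding the factor \<open>length w\<close> up to k + 1 makes the product
        fit this identity, whose factor n + 1 is the one from differentiating the power.\<close>
      also have "real (Suc k) * real ((Suc k + n) choose n) = real (Suc n) * real ((k + Suc n) choose Suc n)"
        using Suc_times_binomial_add [of n k]
        by (simp only: of_nat_mult [symmetric]) (simp add: add.commute)
      also have "(C * F) * \<dots> = g' u" by (simp add: F_def g'_def E_def mult_ac)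
      finally show ?thesis .
    qed
    have "g t0 - s w t0 \<le> g t - s w t"
    proof (rule nondecreasing_of_derivative_within [OF \<open>0 \<le> t0\<close> Suc.prems(3)])
      show "((\<lambda>u. g u - s w u) has_real_derivative g' u - s' w u) (at u within {0..})" if "0 \<le> u" for u
        by (intro derivative_intros dg deriv Suc.prems that)
      show "0 \<le> g' u - s' w u" if "t0 < u" for u using s' [of u] that by simp
    qed
    moreover have "g t0 + s w t0 \<le> g t + s w t"
    proof (rule nondecreasing_of_derivative_within [OF \<open>0 \<le> t0\<close> Suc.prems(3)])
      show "((\<lambda>u. g u + s w u) has_real_derivative g' u + s' w u) (at u within {0..})" if "0 \<le> u" for u
        by (intro derivative_intros dg deriv Suc.prems that)
      show "0 \<le> g' u + s' w u" if "t0 < u" for u using s' [of u] that by simp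
    qed
    ultimately show ?case
      using zero [OF Suc.prems(1)] unfolding g_def E_def by simp
  qed
  have local: "s w t = 0"
    if t0: "0 \<le> t0" "\<And>w. set w \<subseteq> A \<Longrightarrow> s w t0 = 0" and w: "set w \<subseteq> A"
      and t: "t0 \<le> t" "t \<le> t0 + \<delta>" for t0 w t
  proof -
    define k where "k = length w"
    have small: "2 * R * C * (t - t0) \<le> 1 / 2"
    proof -
      have "2 * R * C * (t - t0) \<le> 2 * R * (C + 1) * \<delta>" using R C t by (intro mult_mono) auto
      also have "\<dots> = 1 / 2"
      proof -
        have "(C + 1) * R \<noteq> 0" using R C by simp
        then show ?thesis unfolding \<delta>_def by (simp add: divide_simps)
      qed
      finally show ?thesis .
    qed
    have "\<bar>s w t\<bar> \<le> K * (2 * R) ^ k * (1 / 2) ^ n" for n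
    proof -
      have "real ((k + n) choose n) \<le> 2 ^ (k + n)"
        using binomial_le_pow2 [of "k + n" n] by (metis of_nat_le_iff of_nat_numeral of_nat_power)
      then have "K * R ^ (k + n) * C ^ n * real ((k + n) choose n) * (t - t0) ^ n
          \<le> K * R ^ (k + n) * C ^ n * 2 ^ (k + n) * (t - t0) ^ n"
        using K R C t by (intro mult_right_mono mult_left_mono) auto
      also have "\<dots> = K * (2 * R) ^ k * (2 * R * C * (t - t0)) ^ n"
        by (simp add: power_add power_mult_distrib)
      also have "\<dots> \<le> K * (2 * R) ^ k * (1 / 2) ^ n"
        using small K R C t by (intro mult_left_mono power_mono) auto
      finally show ?thesis using est [OF t0 w, of k t n] t by (simp add: k_def)
    qed
    moreover have "(\<lambda>n. K * (2 * R) ^ k * (1 / 2) ^ n) \<longlonglongrightarrow> K * (2 * R) ^ k * 0"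
      by (intro tendsto_intros LIMSEQ_power_zero) simp
    ultimately have "\<bar>s w t\<bar> \<le> 0"
      by (intro LIMSEQ_le_const [of "\<lambda>n. K * (2 * R) ^ k * (1 / 2) ^ n"]) auto
    then show ?thesis by simp
  qed
  \<comment> \<open>The length \<open>\<delta>\<close> depends neither on the word nor on the
    starting time, so finitely many steps reach any t.\<close>
  have "\<forall>w t. set w \<subseteq> A \<longrightarrow> 0 \<le> t \<longrightarrow> t \<le> real j * \<delta> \<longrightarrow> s w t = 0" for j
  proof (induction j)
    case 0
    then show ?case using init by auto
  next
    case (Suc j)
    show ?case
    proof (intro allI impI)
      fix w t assume w: "set w \<subseteq> A" and t: "0 \<le> t" "t \<le> real (Suc j) * \<delta>"
      show "s w t = 0"
      proof (cases "t \<le> real j * \<delta>")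
        case True
        then show ?thesis using Suc w t by blast
      next
        case False
        show ?thesis
          by (rule local [of "real j * \<delta>"]) (use False Suc w t \<delta> in \<open>auto simp: algebra_simps\<close>)
      qed
    qed
  qed
  moreover obtain j where "t < real j * \<delta>" using reals_Archimedean3 [OF \<delta>] by blast
  ultimately show ?thesis using assms(8,9) by (meson less_imp_le)
qed

section \<open>Differential inequalities\<close>

text \<open>Gronwall's inequality by an integrating factor. With f and c of arbitrary sign it can be
  applied to -f to look backwards in time, and with c = 0 as plain monotonicity.\<close>

lemma exponential_bound:
  fixes f :: "real \<Rightarrow> real"
  assumes deriv: "\<And>u. 0 \<le> u \<Longrightarrow> (f has_real_derivative f' u) (at u within {0..})"
    and le: "\<And>u. 0 \<le> u \<Longrightarrow> f' u \<le> c * f u" and "0 \<le> s" "s \<le> t"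
  shows "f t \<le> exp (c * (t - s)) * f s"
proof -
  have "- (exp (- c * s) * f s) \<le> - (exp (- c * t) * f t)"
  proof (rule nondecreasing_of_derivative_within [OF \<open>0 \<le> s\<close> \<open>s \<le> t\<close>])
    show "((\<lambda>u. - (exp (- c * u) * f u)) has_real_derivative exp (- c * u) * (c * f u - f' u)) (at u within {0..})"
      if "0 \<le> u" for u
      by (auto intro!: derivative_eq_intros deriv that simp: algebra_simps)
    show "0 \<le> exp (- c * u) * (c * f u - f' u)" if "s < u" for u
      using le [of u] that \<open>0 \<le> s\<close> by simp
  qed
  then have "exp (c * t) * (exp (- c * t) * f t) \<le> exp (c * t) * (exp (- c * s) * f s)"
    by (intro mult_left_mono) auto
  moreover have "exp (c * t) * (exp (- c * t) * f t) = f t"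
    "exp (c * t) * (exp (- c * s) * f s) = exp (c * (t - s)) * f s"
    by (simp_all add: mult.assoc [symmetric] exp_add [symmetric] right_diff_distrib)
  ultimately show ?thesis by (simp only:)
qed

text \<open>With \<open>\<Phi> t\<close> the right-hand side of the assumed inequality, \<open>(1 / \<Phi> t - 1 / 2) e\<^bsup>-2\<kappa>t\<^esup>\<close> is nondecreasing.\<close>

lemma logistic_bound:
  fixes E :: "real \<Rightarrow> real"
  assumes cont: "continuous_on {0..} E" and "0 < \<kappa>" and E0: "0 \<le> E 0" "E 0 < 2"
    and le: "\<And>t. 0 \<le> t \<Longrightarrow> E t \<le> E 0 * exp (- 2 * \<kappa> * integral {0..t} (\<lambda>s. 1 - E s / 2))"
    and "0 \<le> t"
  shows "E t \<le> 2 * E 0 / ((2 - E 0) * exp (2 * \<kappa> * t) + E 0)"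
proof (cases "E 0 = 0")
  case True
  then show ?thesis using le [OF \<open>0 \<le> t\<close>] by simp
next
  case False
  then have pos: "0 < E 0" using E0 by simp
  define A where "A t = integral {0..t} (\<lambda>s. 1 - E s / 2)" for t
  \<comment> \<open>The reciprocal of the assumed bound; it is differentiable although E is merely
    continuous. In the derivative of \<open>(u t - 1 / 2) * exp (- 2 * \<kappa> * t)\<close>
    everything cancels up to positive factors times \<open>1 - E t * u t\<close>, which is
    nonnegative by the assumed bound.\<close>
  define u where "u t = exp (2 * \<kappa> * A t) / E 0" for t
  have dA: "(A has_real_derivative 1 - E s / 2) (at s within {0..})" if "0 \<le> s" for s
    unfolding A_def by (rule has_real_derivative_integral [OF _ that]) (auto intro!: continuous_intros cont)
  have Eu: "E s * u s \<le> 1" if "0 \<le> s" for s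
  proof -
    have "E s * u s \<le> (E 0 * exp (- 2 * \<kappa> * A s)) * u s"
      using le [OF that] pos by (intro mult_right_mono) (auto simp: A_def u_def)
    also have "\<dots> = 1" using pos by (simp add: u_def exp_minus)
    finally show ?thesis .
  qed
  have "(u 0 - 1 / 2) * exp (- 2 * \<kappa> * 0) \<le> (u t - 1 / 2) * exp (- 2 * \<kappa> * t)"
  proof (rule nondecreasing_of_derivative_within [OF _ \<open>0 \<le> t\<close>])
    show "((\<lambda>t. (u t - 1 / 2) * exp (- 2 * \<kappa> * t)) has_real_derivative
        \<kappa> * exp (- 2 * \<kappa> * s) * (1 - E s * u s)) (at s within {0..})" if "0 \<le> s" for s
      unfolding u_def using pos
      by (auto intro!: derivative_eq_intros dA that simp: field_simps)
    show "0 \<le> \<kappa> * exp (- 2 * \<kappa> * s) * (1 - E s * u s)" if "0 < s" for s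
      using Eu [of s] that \<open>0 < \<kappa>\<close> by simp
  qed simp
  then have "exp (2 * \<kappa> * t) * (u 0 - 1 / 2) \<le> exp (2 * \<kappa> * t) * ((u t - 1 / 2) * exp (- 2 * \<kappa> * t))"
    by simp
  also have "\<dots> = u t - 1 / 2" by (simp add: exp_minus)
  finally have "exp (2 * \<kappa> * t) * (1 / E 0 - 1 / 2) + 1 / 2 \<le> u t" by (simp add: u_def A_def)
  also have "exp (2 * \<kappa> * t) * (1 / E 0 - 1 / 2) + 1 / 2
      = ((2 - E 0) * exp (2 * \<kappa> * t) + E 0) / (2 * E 0)"
    using pos by (simp add: field_simps)
  finally have v: "((2 - E 0) * exp (2 * \<kappa> * t) + E 0) / (2 * E 0) \<le> u t" .
  have v0: "0 < (2 - E 0) * exp (2 * \<kappa> * t) + E 0" using pos E0 by (simp add: add_pos_pos)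
  have "E t \<le> 1 / u t"
    using Eu [OF \<open>0 \<le> t\<close>] pos by (simp add: u_def field_simps)
  also have "\<dots> \<le> 1 / (((2 - E 0) * exp (2 * \<kappa> * t) + E 0) / (2 * E 0))"
    using v v0 pos by (intro divide_left_mono) (auto simp: u_def)
  also have "\<dots> = 2 * E 0 / ((2 - E 0) * exp (2 * \<kappa> * t) + E 0)" by simp
  finally show ?thesis .
qed

section \<open>Weak solutions and their characteristics\<close>

locale lohe_solution =
  fixes \<kappa> :: real
    and \<mu> :: "(complex^'d^'d) measure"
    and \<rho> :: "real \<Rightarrow> complex^'d^'d \<Rightarrow> real"
    and F :: "real \<Rightarrow> real \<Rightarrow> complex^'d^'d \<Rightarrow> complex^'d^'d"
  assumes haar: "normalized_haar \<mu>"
    and density: "\<And>t. t \<ge> 0 \<Longrightarrow> prob_density \<mu> (\<rho> t)"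
    and continuity: "weakly_continuous_in_time \<mu> \<rho>"
    and solution: "lohe_weak_solution \<kappa> \<mu> \<rho>"
    and flow: "lohe_flow \<kappa> \<mu> \<rho> F"
    and kappa: "\<kappa> > 0"
begin

section \<open>Integrals against the density at time t\<close>

definition P :: "real \<Rightarrow> (complex^'d^'d) measure" where
  "P t = with_density \<mu> (\<rho> t)"

text \<open>As \<open>riccati\<close> is linear in its first argument, the velocity field depends on
  the density only through this matrix.\<close>

definition mean :: "real \<Rightarrow> complex^'d^'d" where
  "mean t = (\<integral>V. V \<partial>P t)"

lemma sets_mu: "sets \<mu> = sets (restrict_space borel unitary_group)"
  using haar by (simp add: normalized_haar_def)

lemma space_mu: "space \<mu> = unitary_group"
  using sets_eq_imp_space_eq [OF sets_mu] by (simp add: space_restrict_space)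

lemma sets_P [simp]: "sets (P t) = sets \<mu>" and space_P [simp]: "space (P t) = unitary_group"
  by (simp_all add: P_def with_density_def space_mu)

lemma measurable_mu: "continuous_on unitary_group f \<Longrightarrow> f \<in> borel_measurable \<mu>"
  using borel_measurable_continuous_on_restrict [of unitary_group f]
    measurable_cong_sets [OF sets_mu refl, of borel] by blast

lemma measurable_P: "continuous_on unitary_group f \<Longrightarrow> f \<in> borel_measurable (P t)"
  using measurable_mu [of f] measurable_cong_sets [OF sets_P refl, of t borel] by blast

lemma rho_nonneg: "0 \<le> t \<Longrightarrow> U \<in> unitary_group \<Longrightarrow> 0 \<le> \<rho> t U"
  using density by (auto simp: prob_density_def space_mu)

lemma measurable_rho: "0 \<le> t \<Longrightarrow> \<rho> t \<in> borel_measurable \<mu>"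
  using density by (auto simp: prob_density_def)

lemma prob_space_P: "0 \<le> t \<Longrightarrow> prob_space (P t)"
  using density by (auto simp: prob_density_def P_def)

lemma integrable_P:
  fixes f :: "complex^'d^'d \<Rightarrow> 'b::{banach, second_countable_topology}"
  assumes "0 \<le> t" "continuous_on unitary_group f"
  shows "integrable (P t) f"
proof -
  interpret prob_space "P t" by (rule prob_space_P) fact
  obtain B where "\<And>U. U \<in> unitary_group \<Longrightarrow> norm (f U) \<le> B"
    using compact_imp_bounded [OF compact_continuous_image [OF assms(2) compact_unitary_group]]
    by (auto simp: bounded_iff)
  then show ?thesis
    by (intro integrable_const_bound [of _ B]) (auto intro: measurable_P assms)
qed

lemma integral_P:
  fixes f :: "complex^'d^'d \<Rightarrow> 'b::{banach, second_countable_topology}"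
  assumes "0 \<le> t" "continuous_on unitary_group f"
  shows "(\<integral>U. f U \<partial>P t) = (\<integral>U. \<rho> t U *\<^sub>R f U \<partial>\<mu>)"
  unfolding P_def with_density_def
  using assms by (intro integral_density measurable_mu measurable_rho AE_I2) (auto simp: rho_nonneg space_mu)

lemma AE_P_pos: "0 \<le> t \<Longrightarrow> AE U in P t. 0 < \<rho> t U"
  unfolding P_def with_density_def using measurable_rho by (subst AE_density) auto

text \<open>The bound is asked only where the density is positive. At time 0 this restricts
  attention to the starting points counted in \<open>lohe_D\<close>.\<close>

lemma integral_P_le:
  fixes b :: real
  assumes "0 \<le> t" "continuous_on unitary_group f"
    and "\<And>U. U \<in> unitary_group \<Longrightarrow> 0 < \<rho> t U \<Longrightarrow> f U \<le> b"
  shows "(\<integral>U. f U \<partial>P t) \<le> b"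
proof -
  interpret prob_space "P t" by (rule prob_space_P) fact
  have "AE U in P t. f U \<le> b"
    using AE_P_pos [OF assms(1)] AE_space by eventually_elim (use assms(3) in auto)
  with integrable_P [OF assms(1,2)] show ?thesis by (rule integral_le_const)
qed

lemma integral_P_ge:
  fixes b :: real
  assumes "0 \<le> t" "continuous_on unitary_group f"
    and "\<And>U. U \<in> unitary_group \<Longrightarrow> 0 < \<rho> t U \<Longrightarrow> b \<le> f U"
  shows "b \<le> (\<integral>U. f U \<partial>P t)"
proof -
  have "(\<integral>U. - f U \<partial>P t) \<le> - b"
    by (intro integral_P_le continuous_on_minus assms) (use assms(3) in simp)
  then show ?thesis by simp
qed

lemma integral_P_abs_le:
  fixes b :: real
  assumes "0 \<le> t" "continuous_on unitary_group f" "\<And>U. U \<in> unitary_group \<Longrightarrow> \<bar>f U\<bar> \<le> b"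
  shows "\<bar>\<integral>U. f U \<partial>P t\<bar> \<le> b"
proof (rule abs_leI)
  show "(\<integral>U. f U \<partial>P t) \<le> b" by (rule integral_P_le) (use assms in \<open>auto simp: abs_le_iff\<close>)
  have "- b \<le> (\<integral>U. f U \<partial>P t)" by (rule integral_P_ge) (use assms in \<open>auto simp: abs_le_iff minus_le_iff\<close>)
  then show "- (\<integral>U. f U \<partial>P t) \<le> b" by simp
qed

lemma integral_P_linear:
  fixes T :: "complex^'d^'d \<Rightarrow> 'b::{banach, second_countable_topology}"
  assumes "bounded_linear T" "0 \<le> t"
  shows "(\<integral>V. T V \<partial>P t) = T (mean t)"
  unfolding mean_def
  by (rule integral_bounded_linear) (use assms in \<open>auto intro: integrable_P continuous_on_id\<close>)

lemma continuous_on_integral_P: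
  fixes \<phi> :: "complex^'d^'d \<Rightarrow> real"
  assumes "continuous_on unitary_group \<phi>"
  shows "continuous_on {0..} (\<lambda>t. \<integral>U. \<phi> U \<partial>P t)"
proof -
  have "continuous_on {0..} (\<lambda>t. \<integral>U. \<rho> t U * \<phi> U \<partial>\<mu>)"
    using continuity assms by (auto simp: weakly_continuous_in_time_def)
  then show ?thesis
    by (rule continuous_on_eq) (use assms in \<open>auto simp: integral_P\<close>)
qed

lemma norm_mean_le: "0 \<le> t \<Longrightarrow> norm (mean t) \<le> norm (mat 1 :: complex^'d^'d)"
proof -
  assume t: "0 \<le> t"
  have "norm (mean t) \<le> (\<integral>V. norm V \<partial>P t)"
    unfolding mean_def by (rule integral_norm_bound)
  also have "\<dots> \<le> norm (mat 1 :: complex^'d^'d)"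
    by (rule integral_P_le [OF t]) (auto intro!: continuous_intros simp: norm_unitary)
  finally show ?thesis .
qed

section \<open>Characteristics and the flow\<close>

definition characteristic :: "(real \<Rightarrow> complex^'d^'d) \<Rightarrow> bool" where
  "characteristic x \<longleftrightarrow> (\<forall>t\<ge>0. x t \<in> unitary_group \<and>
     (x has_vector_derivative (\<kappa> / 2) *\<^sub>R riccati (mean t) (x t)) (at t within {0..}))"

lemma flow_in_unitary_group: "0 \<le> s \<Longrightarrow> 0 \<le> t \<Longrightarrow> U \<in> unitary_group \<Longrightarrow> F t s U \<in> unitary_group"
  using flow by (auto simp: lohe_flow_def)

lemma flow_same: "0 \<le> s \<Longrightarrow> U \<in> unitary_group \<Longrightarrow> F s s U = U"
  using flow by (auto simp: lohe_flow_def)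

lemma characteristic_flow:
  assumes "0 \<le> s" "U \<in> unitary_group"
  shows "characteristic (\<lambda>t. F t s U)"
  unfolding characteristic_def
proof (intro allI impI conjI)
  fix t :: real assume t: "0 \<le> t"
  show W: "F t s U \<in> unitary_group" by (rule flow_in_unitary_group) fact+
  have "(\<integral>V. \<rho> t V *\<^sub>R (lohe_K V (F t s U) ** F t s U) \<partial>\<mu>) = (\<integral>V. riccati V (F t s U) \<partial>P t)"
    using t by (simp add: lohe_K_mult [OF W] integral_P continuous_intros)
  also have "\<dots> = riccati (mean t) (F t s U)"
    by (rule integral_P_linear [OF bounded_linear_riccati t])
  finally have eq: "(\<integral>V. \<rho> t V *\<^sub>R (lohe_K V (F t s U) ** F t s U) \<partial>\<mu>) = riccati (mean t) (F t s U)" .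
  have "((\<lambda>\<tau>. F \<tau> s U) has_vector_derivative
      (\<kappa> / 2) *\<^sub>R (\<integral>V. \<rho> t V *\<^sub>R (lohe_K V (F t s U) ** F t s U) \<partial>\<mu>)) (at t within {0..})"
    using flow assms t unfolding lohe_flow_def by blast
  then show "((\<lambda>t. F t s U) has_vector_derivative (\<kappa> / 2) *\<^sub>R riccati (mean t) (F t s U)) (at t within {0..})"
    unfolding eq .
qed

lemma characteristic_dist_derivative:
  assumes "characteristic x" "characteristic y" "0 \<le> t"
  shows "((\<lambda>t. (norm (x t - y t))\<^sup>2) has_real_derivative
    \<kappa> * ((x t - y t) \<bullet> (riccati (mean t) (x t) - riccati (mean t) (y t)))) (at t within {0..})"
proof -
  have "((\<lambda>t. x t - y t) has_vector_derivative
      (\<kappa> / 2) *\<^sub>R (riccati (mean t) (x t) - riccati (mean t) (y t))) (at t within {0..})"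
    using assms unfolding characteristic_def scaleR_diff_right by (intro has_vector_derivative_diff) auto
  from bounded_bilinear.has_vector_derivative [OF bounded_bilinear_inner this this] show ?thesis
    unfolding has_real_derivative_iff_has_vector_derivative power2_norm_eq_inner
    by (rule has_vector_derivative_eq_rhs) (simp add: inner_commute inner_diff_right algebra_simps)
qed

text \<open>The mean is in general not unitary, so estimates are made for unitary values
  \<open>h Z\<close> and then averaged. This is used with h the identity under \<open>P t\<close>
  and with h the flow map under \<open>P 0\<close>.\<close>

lemma inner_riccati_average:
  assumes "0 \<le> s" "continuous_on unitary_group h"
  shows "(x - y) \<bullet> (riccati (\<integral>Z. h Z \<partial>P s) x - riccati (\<integral>Z. h Z \<partial>P s) y)
    = (\<integral>Z. (x - y) \<bullet> (riccati (h Z) x - riccati (h Z) y) \<partial>P s)"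
proof -
  have "bounded_linear (\<lambda>M. (x - y) \<bullet> (riccati M x - riccati M y))"
    by (intro bounded_linear_compose [OF bounded_linear_inner_right] bounded_linear_sub bounded_linear_riccati)
  from integral_bounded_linear [OF this integrable_P [OF assms]] show ?thesis by simp
qed

text \<open>The squared distance f satisfies |f'| \<le> 2 \<open>\<kappa>\<close> f, and Gronwall
  runs in both time directions. The two-sided form yields uniqueness, Lipschitz dependence on the
  datum, continuity of D(t)^2 and finally the lower estimate.\<close>

lemma characteristic_dist_le:
  assumes x: "characteristic x" and y: "characteristic y" and "0 \<le> s" "0 \<le> t"
  shows "(norm (x t - y t))\<^sup>2 \<le> exp (2 * \<kappa> * \<bar>t - s\<bar>) * (norm (x s - y s))\<^sup>2"
proof -
  define f where "f t = (norm (x t - y t))\<^sup>2" for t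
  define f' where "f' t = \<kappa> * ((x t - y t) \<bullet> (riccati (mean t) (x t) - riccati (mean t) (y t)))" for t
  have f: "(f has_real_derivative f' t) (at t within {0..})" if "0 \<le> t" for t
    unfolding f_def f'_def by (rule characteristic_dist_derivative [OF x y that])
  have G: "x t \<in> unitary_group" "y t \<in> unitary_group" if "0 \<le> t" for t
    using x y that by (auto simp: characteristic_def)
  have f': "f' t \<le> 2 * \<kappa> * f t" "- (2 * \<kappa> * f t) \<le> f' t" if t: "0 \<le> t" for t
  proof -
    have avg: "f' t = \<kappa> * (\<integral>Z. (x t - y t) \<bullet> (riccati Z (x t) - riccati Z (y t)) \<partial>P t)"
      unfolding f'_def mean_def using inner_riccati_average [OF t continuous_on_id] by simp
    have upper: "(\<integral>Z. (x t - y t) \<bullet> (riccati Z (x t) - riccati Z (y t)) \<partial>P t) \<le> 2 * f t"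
      unfolding f_def by (intro integral_P_le continuous_intros inner_riccati_diff G t)
    have lower: "- 2 * f t \<le> (\<integral>Z. (x t - y t) \<bullet> (riccati Z (x t) - riccati Z (y t)) \<partial>P t)"
      unfolding f_def by (intro integral_P_ge continuous_intros inner_riccati_diff G t)
    show "f' t \<le> 2 * \<kappa> * f t"
      using mult_left_mono [OF upper, of \<kappa>] kappa by (simp add: avg mult_ac)
    show "- (2 * \<kappa> * f t) \<le> f' t"
      using mult_left_mono [OF lower, of \<kappa>] kappa by (simp add: avg mult_ac)
  qed
  show ?thesis
  proof (cases "s \<le> t")
    case True
    then show ?thesis
      using exponential_bound [of f f' "2 * \<kappa>" s t] f f' \<open>0 \<le> s\<close> by (simp add: f_def)
  next
    case False
    have "- f s \<le> exp (- 2 * \<kappa> * (s - t)) * - f t"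
    proof (rule exponential_bound [of _ "\<lambda>u. - f' u"])
      show "((\<lambda>u. - f u) has_real_derivative - f' u) (at u within {0..})" if "0 \<le> u" for u
        by (intro derivative_intros f that)
      show "- f' u \<le> - 2 * \<kappa> * - f u" if "0 \<le> u" for u using f'(2) [OF that] f'(1) [OF that] by simp
    qed (use False assms in auto)
    then have "exp (2 * \<kappa> * (s - t)) * (exp (- 2 * \<kappa> * (s - t)) * f t) \<le> exp (2 * \<kappa> * (s - t)) * f s"
      by (intro mult_left_mono) auto
    moreover have "exp (2 * \<kappa> * (s - t)) * (exp (- 2 * \<kappa> * (s - t)) * f t) = f t"
      by (simp add: mult.assoc [symmetric] exp_add [symmetric])
    moreover have "\<bar>t - s\<bar> = s - t" using False by simp
    ultimately show ?thesis by (simp only: f_def)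
  qed
qed

lemma characteristic_unique:
  assumes "characteristic x" "characteristic y" "0 \<le> s" "0 \<le> t" "x s = y s"
  shows "x t = y t"
proof -
  have "x s - y s = 0" using assms(5) by simp
  then have "(norm (x t - y t))\<^sup>2 \<le> 0" using characteristic_dist_le [OF assms(1-4)] by simp
  then show ?thesis by simp
qed

text \<open>Characteristics live on the whole half-line, before and after the time of their datum.
  The two curves compared here agree at time s, hence at time t.\<close>

lemma flow_inverse:
  assumes "0 \<le> s" "0 \<le> t" "U \<in> unitary_group"
  shows "F t s (F s t U) = U"
proof -
  have FU: "F s t U \<in> unitary_group" by (rule flow_in_unitary_group) fact+
  have "F t s (F s t U) = F t t U"
  proof (rule characteristic_unique [of "\<lambda>\<tau>. F \<tau> s (F s t U)" "\<lambda>\<tau>. F \<tau> t U" s t])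
    show "characteristic (\<lambda>\<tau>. F \<tau> s (F s t U))" by (rule characteristic_flow [OF \<open>0 \<le> s\<close> FU])
    show "characteristic (\<lambda>\<tau>. F \<tau> t U)" by (rule characteristic_flow) fact+
    show "F s s (F s t U) = F s t U" by (rule flow_same [OF \<open>0 \<le> s\<close> FU])
  qed fact+
  then show ?thesis using flow_same [OF assms(2,3)] by simp
qed

lemma flow_image_subset: "0 \<le> s \<Longrightarrow> 0 \<le> t \<Longrightarrow> F t s ` unitary_group \<subseteq> unitary_group"
  by (rule image_subsetI) (rule flow_in_unitary_group)

lemma bij_betw_flow:
  assumes "0 \<le> t"
  shows "bij_betw (F t 0) unitary_group unitary_group"
proof (rule bij_betw_byWitness)
  show "\<forall>U\<in>unitary_group. F 0 t (F t 0 U) = U" "\<forall>U\<in>unitary_group. F t 0 (F 0 t U) = U"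
    by (rule ballI, rule flow_inverse; use assms in simp)+
qed (rule flow_image_subset; use assms in simp)+

lemma continuous_on_flow:
  assumes "0 \<le> t"
  shows "continuous_on unitary_group (F t 0)"
proof -
  have "(exp (\<kappa> * t))-lipschitz_on unitary_group (F t 0)"
  proof (rule lipschitz_onI)
    fix U V :: "complex^'d^'d" assume UV: "U \<in> unitary_group" "V \<in> unitary_group"
    have "(norm (F t 0 U - F t 0 V))\<^sup>2 \<le> exp (2 * \<kappa> * t) * (norm (U - V))\<^sup>2"
      using characteristic_dist_le [OF characteristic_flow characteristic_flow, of 0 U 0 V 0 t] UV assms
      by (simp add: flow_same)
    also have "\<dots> = (exp (\<kappa> * t) * norm (U - V))\<^sup>2"
      by (simp add: power_mult_distrib exp_double mult.assoc)
    finally have sq: "(norm (F t 0 U - F t 0 V))\<^sup>2 \<le> (exp (\<kappa> * t) * norm (U - V))\<^sup>2" .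
    show "dist (F t 0 U) (F t 0 V) \<le> exp (\<kappa> * t) * dist U V"
      unfolding dist_norm by (rule power2_le_imp_le [OF sq]) simp
  qed simp
  then show ?thesis by (rule lipschitz_on_continuous_on)
qed

lemma continuous_on_compose_flow:
  assumes "0 \<le> t" "continuous_on unitary_group f"
  shows "continuous_on unitary_group (\<lambda>U. f (F t 0 U))"
  by (rule continuous_on_compose2 [OF assms(2) continuous_on_flow [OF assms(1)]])
    (rule flow_image_subset [OF order_refl assms(1)])

section \<open>Transport of the initial density\<close>

text \<open>After integration over \<open>V\<close> only the direction of the flow enters the weak formulation, so that the
  flow itself provides the curve along which two derivatives within the group are compared.\<close>

lemma differential_riccati_unique:
  assumes t: "0 < t" and U: "U \<in> unitary_group"
    and D: "(\<phi> has_derivative D) (at U within unitary_group)"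
    and D': "(\<phi> has_derivative D') (at U within unitary_group)"
  shows "D (riccati (mean t) U) = D' (riccati (mean t) U)"
proof -
  define x where "x \<tau> = F \<tau> t U" for \<tau>
  have xt: "x t = U" using t U by (simp add: x_def flow_same)
  have x: "(x has_vector_derivative (\<kappa> / 2) *\<^sub>R riccati (mean t) U) (at t within {0..})"
  proof -
    have "characteristic x" unfolding x_def using t U by (intro characteristic_flow) auto
    then have "(x has_vector_derivative (\<kappa> / 2) *\<^sub>R riccati (mean t) (x t)) (at t within {0..})"
      using t by (simp add: characteristic_def)
    then show ?thesis by (simp only: xt)
  qed
  have sub: "x ` {0..} \<subseteq> unitary_group"
    using t U by (auto simp: x_def intro: flow_in_unitary_group)
  have chain: "(\<phi> \<circ> x has_vector_derivative T ((\<kappa> / 2) *\<^sub>R riccati (mean t) U)) (at t within {0..})"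
    if "(\<phi> has_derivative T) (at U within unitary_group)" for T
    by (rule vector_derivative_diff_chain_within [OF x]) (use has_derivative_subset [OF that sub] xt in simp)
  have "at t within {0..} = at t" using t by (intro at_within_interior) simp
  then have "D ((\<kappa> / 2) *\<^sub>R riccati (mean t) U) = D' ((\<kappa> / 2) *\<^sub>R riccati (mean t) U)"
    using vector_derivative_unique_at chain [OF D] chain [OF D'] by auto
  then show ?thesis
    using kappa by (simp add: linear_cmul [OF has_derivative_linear [OF D]]
        linear_cmul [OF has_derivative_linear [OF D']])
qed

text \<open>\<open>frechet_derivative\<close> selects some derivative T, not determined off the
  tangent space. Its linearity moves the integral over V inside, and T is then evaluated only in the
  direction of the flow, where it agrees with the derivative of the polynomial.\<close>

lemma weak_formulation_word:
  assumes t: "0 < t"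
  shows "(\<integral>U. (\<integral>V. unitary_differential (word w) U (lohe_K V U ** U) * \<rho> t V * \<rho> t U \<partial>\<mu>) \<partial>\<mu>)
    = (\<integral>U. word_derivative w U (riccati (mean t) U) \<partial>P t)"
proof -
  have "(\<integral>V. unitary_differential (word w) U (lohe_K V U ** U) * \<rho> t V * \<rho> t U \<partial>\<mu>)
      = \<rho> t U *\<^sub>R word_derivative w U (riccati (mean t) U)" if U: "U \<in> unitary_group" for U
  proof -
    define T where "T = frechet_derivative (word w) (at U within unitary_group)"
    have T: "(word w has_derivative T) (at U within unitary_group)"
      unfolding T_def by (rule frechet_derivative_works [THEN iffD1]) (use has_derivative_word in \<open>auto simp: differentiable_def\<close>)
    have bl: "bounded_linear (\<lambda>V. T (riccati V U))"
      by (intro bounded_linear_compose [OF has_derivative_bounded_linear [OF T]] bounded_linear_riccati)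
    have "(\<integral>V. unitary_differential (word w) U (lohe_K V U ** U) * \<rho> t V * \<rho> t U \<partial>\<mu>)
        = (\<integral>V. (\<rho> t V *\<^sub>R T (riccati V U)) * \<rho> t U \<partial>\<mu>)"
      by (simp add: unitary_differential_def T_def lohe_K_mult [OF U] mult_ac)
    also have "\<dots> = (\<integral>V. T (riccati V U) \<partial>P t) * \<rho> t U"
      using t bl by (subst integral_P) (auto intro: linear_continuous_on)
    also have "(\<integral>V. T (riccati V U) \<partial>P t) = T (riccati (mean t) U)"
      using integral_P_linear [OF bl] t by simp
    also have "\<dots> = word_derivative w U (riccati (mean t) U)"
      by (rule differential_riccati_unique [OF t U T has_derivative_word])
    finally show ?thesis by simp
  qed
  then have "(\<integral>U. (\<integral>V. unitary_differential (word w) U (lohe_K V U ** U) * \<rho> t V * \<rho> t U \<partial>\<mu>) \<partial>\<mu>)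
      = (\<integral>U. \<rho> t U *\<^sub>R word_derivative w U (riccati (mean t) U) \<partial>\<mu>)"
    by (intro Bochner_Integration.integral_cong refl) (simp add: space_mu)
  also have "\<dots> = (\<integral>U. word_derivative w U (riccati (mean t) U) \<partial>P t)"
    using t by (intro integral_P [symmetric] continuous_intros) simp
  finally show ?thesis .
qed

text \<open>Weak continuity covers fixed integrands, whereas this one moves with
  \<open>mean t\<close>. It is linear in the mean, so expanding in a basis gives a finite sum of
  products of continuous functions.\<close>

lemma continuous_on_mean_derivative:
  "continuous_on {0..} (\<lambda>t. \<integral>U. word_derivative w U (riccati (mean t) U) \<partial>P t)"
proof -
  have "continuous_on {0..} (\<lambda>t. \<Sum>b\<in>Basis. (\<integral>V. V \<bullet> b \<partial>P t) * (\<integral>U. word_derivative w U (riccati b U) \<partial>P t))"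
    by (intro continuous_intros continuous_on_integral_P)
  then show ?thesis
  proof (rule continuous_on_eq)
    fix t :: real assume "t \<in> {0..}"
    then have t: "0 \<le> t" by simp
    have "riccati (mean t) U = (\<Sum>b\<in>Basis. (mean t \<bullet> b) *\<^sub>R riccati b U)" for U
    proof -
      have "riccati (mean t) U = riccati (\<Sum>b\<in>Basis. (mean t \<bullet> b) *\<^sub>R b) U"
        by (simp add: euclidean_representation)
      also have "\<dots> = (\<Sum>b\<in>Basis. (mean t \<bullet> b) *\<^sub>R riccati b U)"
        by (simp add: linear_sum [OF bounded_linear.linear [OF bounded_linear_riccati]]
            linear_cmul [OF bounded_linear.linear [OF bounded_linear_riccati]])
      finally show ?thesis .
    qed
    then have "(\<integral>U. word_derivative w U (riccati (mean t) U) \<partial>P t)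
        = (\<integral>U. (\<Sum>b\<in>Basis. (mean t \<bullet> b) * word_derivative w U (riccati b U)) \<partial>P t)"
      by (simp add: blinfun.sum_right blinfun.scaleR_right)
    also have "\<dots> = (\<Sum>b\<in>Basis. (mean t \<bullet> b) * (\<integral>U. word_derivative w U (riccati b U) \<partial>P t))"
      by (subst Bochner_Integration.integral_sum)
        (auto intro!: integrable_P t continuous_intros)
    also have "\<dots> = (\<Sum>b\<in>Basis. (\<integral>V. V \<bullet> b \<partial>P t) * (\<integral>U. word_derivative w U (riccati b U) \<partial>P t))"
      by (simp add: integral_P_linear [OF bounded_linear_inner_left t])
    finally show "(\<Sum>b\<in>Basis. (\<integral>V. V \<bullet> b \<partial>P t) * (\<integral>U. word_derivative w U (riccati b U) \<partial>P t))
        = (\<integral>U. word_derivative w U (riccati (mean t) U) \<partial>P t)" by simp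
  qed
qed

lemma moment_derivative:
  assumes "0 \<le> t"
  shows "((\<lambda>t. \<integral>U. word w U \<partial>P t) has_real_derivative
    \<kappa> / 2 * (\<integral>U. word_derivative w U (riccati (mean t) U) \<partial>P t)) (at t within {0..})"
proof (rule has_real_derivative_of_weak_derivative [OF _ _ _ assms])
  show "continuous_on {0..} (\<lambda>t. \<integral>U. word w U \<partial>P t)"
    by (intro continuous_on_integral_P continuous_intros)
  show "continuous_on {0..} (\<lambda>t. \<kappa> / 2 * (\<integral>U. word_derivative w U (riccati (mean t) U) \<partial>P t))"
    by (intro continuous_intros continuous_on_mean_derivative)
  fix \<eta> assume "time_test_function \<eta>"
  then have "- (LBINT t:{0<..}. deriv \<eta> t * (\<integral>U. \<rho> t U * word w U \<partial>\<mu>)) =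
      (LBINT t:{0<..}. \<eta> t * (\<kappa> / 2 *
        (\<integral>U. (\<integral>V. unitary_differential (word w) U (lohe_K V U ** U) * \<rho> t V * \<rho> t U \<partial>\<mu>) \<partial>\<mu>)))"
    using solution C1_unitary_word unfolding lohe_weak_solution_def by blast
  moreover have "(LBINT t:{0<..}. deriv \<eta> t * (\<integral>U. \<rho> t U * word w U \<partial>\<mu>))
      = (LBINT t:{0<..}. deriv \<eta> t * (\<integral>U. word w U \<partial>P t))"
    by (intro set_lebesgue_integral_cong) (auto simp: integral_P continuous_on_word)
  moreover have "(LBINT t:{0<..}. \<eta> t * (\<kappa> / 2 *
        (\<integral>U. (\<integral>V. unitary_differential (word w) U (lohe_K V U ** U) * \<rho> t V * \<rho> t U \<partial>\<mu>) \<partial>\<mu>)))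
      = (LBINT t:{0<..}. \<eta> t * (\<kappa> / 2 * (\<integral>U. word_derivative w U (riccati (mean t) U) \<partial>P t)))"
    by (rule set_lebesgue_integral_cong)
      (simp, intro allI impI, simp only: greaterThan_iff weak_formulation_word)
  ultimately show "- (LBINT t:{0<..}. deriv \<eta> t * (\<integral>U. word w U \<partial>P t)) =
      (LBINT t:{0<..}. \<eta> t * (\<kappa> / 2 * (\<integral>U. word_derivative w U (riccati (mean t) U) \<partial>P t)))"
    by simp
qed

lemma pushforward_moment_derivative:
  assumes t: "0 \<le> t"
  shows "((\<lambda>t. \<integral>U. word w (F t 0 U) \<partial>P 0) has_real_derivative
    \<kappa> / 2 * (\<integral>U. word_derivative w (F t 0 U) (riccati (mean t) (F t 0 U)) \<partial>P 0)) (at t within {0..})"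
proof -
  interpret P0: prob_space "P 0" by (rule prob_space_P) simp
  define h where "h z = \<kappa> / 2 * word_derivative w (fst z) (riccati (snd z) (fst z))"
    for z :: "(complex^'d^'d) \<times> (complex^'d^'d)"
  \<comment> \<open>A compact set containing all pairs \<open>(F s 0 U, mean s)\<close>; the bound
    of h on it is uniform in time and dominates the difference quotients.\<close>
  define B :: "((complex^'d^'d) \<times> (complex^'d^'d)) set"
    where "B = unitary_group \<times> cball 0 (norm (mat 1 :: complex^'d^'d))"
  have "compact B" unfolding B_def by (intro compact_Times compact_unitary_group compact_cball)
  moreover have "continuous_on B h" unfolding h_def by (intro continuous_intros)
  ultimately obtain K where K: "\<And>z. z \<in> B \<Longrightarrow> \<bar>h z\<bar> \<le> K"
    using compact_imp_bounded [OF compact_continuous_image] by (fastforce simp: bounded_iff)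
  have "((\<lambda>t. \<integral>U. word w (F t 0 U) \<partial>P 0) has_real_derivative
      (\<integral>U. h (F t 0 U, mean t) \<partial>P 0)) (at t within {0..})"
  proof (rule has_real_derivative_lebesgue_integral [OF _ t])
    show "finite_measure (P 0)" by unfold_locales
    show "integrable (P 0) (\<lambda>U. word w (F s 0 U))" if "0 \<le> s" for s
      by (intro integrable_P continuous_on_compose_flow [OF that] continuous_intros order_refl)
    have "continuous_on unitary_group (\<lambda>U. h (U, mean t))"
      unfolding h_def by (intro continuous_intros)
    then show "(\<lambda>U. h (F t 0 U, mean t)) \<in> borel_measurable (P 0)"
      by (intro measurable_P continuous_on_compose_flow [OF t])
    show "\<bar>h (F s 0 U, mean s)\<bar> \<le> K" if "U \<in> space (P 0)" "0 \<le> s" for s U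
      by (rule K) (use that norm_mean_le flow_in_unitary_group in \<open>auto simp: B_def\<close>)
    show "((\<lambda>u. word w (F u 0 U)) has_real_derivative h (F s 0 U, mean s)) (at s within {0..})"
      if U: "U \<in> space (P 0)" and s: "0 \<le> s" for s U
    proof -
      have "((\<lambda>u. F u 0 U) has_vector_derivative (\<kappa> / 2) *\<^sub>R riccati (mean s) (F s 0 U)) (at s within {0..})"
        using characteristic_flow [of 0 U] U s by (simp add: characteristic_def)
      from vector_derivative_diff_chain_within [OF this has_derivative_word, of w] show ?thesis
        by (simp add: has_real_derivative_iff_has_vector_derivative h_def comp_def blinfun.scaleR_right)
    qed
  qed
  then show ?thesis by (simp add: h_def)
qed

text \<open>Both measures move with the same field, the one given by the mean of \<open>P t\<close>.
  Hence the defects of the words satisfy a homogeneous linear hierarchy with initial value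
  0.\<close>

definition transport_defect :: "real \<Rightarrow> (complex^'d^'d \<Rightarrow> real) \<Rightarrow> real" where
  "transport_defect t f = (\<integral>U. f U \<partial>P t) - (\<integral>U. f (F t 0 U) \<partial>P 0)"

lemma continuous_functional_transport_defect:
  assumes "0 \<le> t"
  shows "continuous_functional (transport_defect t)"
proof
  fix p q :: "complex^'d^'d \<Rightarrow> real"
  assume "continuous_on UNIV p" "continuous_on UNIV q"
  then have p: "continuous_on unitary_group p" and q: "continuous_on unitary_group q"
    by (auto intro: continuous_on_subset)
  show "transport_defect t (\<lambda>x. p x + q x) = transport_defect t p + transport_defect t q"
    unfolding transport_defect_def using p q assms
    by (simp add: integrable_P continuous_on_compose_flow)
next
  fix p :: "complex^'d^'d \<Rightarrow> real" and c :: real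
  show "transport_defect t (\<lambda>x. c * p x) = c * transport_defect t p"
    unfolding transport_defect_def by (simp add: right_diff_distrib)
qed

lemma transport_defect_abs_le:
  assumes t: "0 \<le> t" and f: "continuous_on UNIV f" and le: "\<And>U. U \<in> unitary_group \<Longrightarrow> \<bar>f U\<bar> \<le> e"
  shows "\<bar>transport_defect t f\<bar> \<le> 2 * e"
proof -
  have f': "continuous_on unitary_group f" using f by (rule continuous_on_subset) simp
  have "\<bar>\<integral>U. f U \<partial>P t\<bar> \<le> e" by (rule integral_P_abs_le [OF t f' le])
  moreover have "\<bar>\<integral>U. f (F t 0 U) \<partial>P 0\<bar> \<le> e"
    by (intro integral_P_abs_le continuous_on_compose_flow t f' le flow_in_unitary_group order_refl)
  ultimately show ?thesis unfolding transport_defect_def by linarith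
qed

lemma transport_defect_word:
  assumes "set w \<subseteq> Basis" "0 \<le> t"
  shows "transport_defect t (word w) = 0"
proof -
  \<comment> \<open>R dominates the norms of unitary matrices and of the means; adding 1 ensures
    \<open>1 \<le> R\<close> without computing the norm.\<close>
  define R where "R = norm (mat 1 :: complex^'d^'d) + 1"
  define C where "C = R * (1 + (real DIM(complex^'d^'d))\<^sup>2)"
  define s' where "s' w t = \<kappa> / 2 * transport_defect t (\<lambda>U. word_derivative w U (riccati (mean t) U))" for w t
  have R: "1 \<le> R" by (simp add: R_def)
  show ?thesis
  proof (rule hierarchy_eq_0 [where s = "\<lambda>w t. transport_defect t (word w)" and A = Basis and s' = s' and K = 2 and R = R and C = "\<kappa> / 2 * C"])
    fix w :: "(complex^'d^'d) list" and t :: real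
    assume w: "set w \<subseteq> Basis" and t: "0 \<le> t"
    show "((\<lambda>t. transport_defect t (word w)) has_real_derivative s' w t) (at t within {0..})"
      unfolding transport_defect_def s'_def right_diff_distrib
      by (intro derivative_intros moment_derivative pushforward_moment_derivative t)
    have "\<bar>word w U\<bar> \<le> R ^ length w" if "U \<in> unitary_group" for U
      by (rule abs_word_le) (use w that in \<open>auto simp: R_def norm_unitary\<close>)
    then show "\<bar>transport_defect t (word w)\<bar> \<le> 2 * R ^ length w"
      by (intro transport_defect_abs_le t continuous_intros)
    fix B assume B: "\<And>v. set v \<subseteq> Basis \<Longrightarrow> length v \<le> Suc (length w) \<Longrightarrow> \<bar>transport_defect t (word v)\<bar> \<le> B"
    have "\<bar>transport_defect t (\<lambda>U. word [] U * word_derivative w U (riccati (mean t) U))\<bar> \<le> real (length w) * C * B"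
      unfolding C_def
      by (rule functional_word_derivative_riccati_le [OF continuous_functional_transport_defect [OF t]])
        (use w B norm_mean_le [OF t] in \<open>auto simp: R_def\<close>)
    then show "\<bar>s' w t\<bar> \<le> real (length w) * (\<kappa> / 2 * C) * B"
      using mult_left_mono [of _ "real (length w) * C * B" "\<kappa> / 2"] kappa
      by (simp add: s'_def abs_mult mult_ac)
  next
    show "transport_defect 0 (word w) = 0" for w
      unfolding transport_defect_def
      by (subst Bochner_Integration.integral_cong [OF refl, of "P 0" "\<lambda>U. word w (F 0 0 U)" "word w"])
        (auto simp: flow_same)
    show "0 \<le> \<kappa> / 2 * C" using kappa R by (simp add: C_def)
  qed (use R assms in auto)
qed

text \<open>The push-forward identity for the flow, tested against continuous functions; K = 2
  counts the two probability measures in the defect.\<close>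

lemma integral_transport:
  fixes f :: "complex^'d^'d \<Rightarrow> real"
  assumes "0 \<le> t" "continuous_on UNIV f"
  shows "(\<integral>U. f U \<partial>P t) = (\<integral>U. f (F t 0 U) \<partial>P 0)"
proof -
  interpret continuous_functional "transport_defect t"
    by (rule continuous_functional_transport_defect) fact
  have "transport_defect t f = 0"
    by (rule eq_0_of_words [where K = 2, OF transport_defect_word transport_defect_abs_le compact_unitary_group])
      (use assms in auto)
  then show ?thesis by (simp add: transport_defect_def)
qed

text \<open>Exhibits the mean as an average of matrices \<open>F t 0 U\<close> with
  \<open>\<rho> 0 U > 0\<close> almost surely, hence at distance at most D(t) from one
  another.\<close>

lemma mean_eq:
  assumes "0 \<le> t"
  shows "mean t = (\<integral>U. F t 0 U \<partial>P 0)"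
proof (rule euclidean_eqI)
  fix b :: "complex^'d^'d" assume "b \<in> Basis"
  have "mean t \<bullet> b = (\<integral>U. U \<bullet> b \<partial>P t)"
    by (simp add: integral_P_linear [OF bounded_linear_inner_left assms])
  also have "\<dots> = (\<integral>U. F t 0 U \<bullet> b \<partial>P 0)"
    by (intro integral_transport assms continuous_intros)
  also have "\<dots> = (\<integral>U. F t 0 U \<partial>P 0) \<bullet> b"
    by (intro integral_bounded_linear [OF bounded_linear_inner_left] integrable_P continuous_on_flow assms order_refl)
  finally show "mean t \<bullet> b = (\<integral>U. F t 0 U \<partial>P 0) \<bullet> b" .
qed

section \<open>Decay of the diameter\<close>

definition initial_set :: "(complex^'d^'d) set" where
  "initial_set = {U \<in> unitary_group. 0 < \<rho> 0 U}"

text \<open>Ensures that the suprema below are taken over nonempty sets. An empty set would force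
  the integral of 1 to be at most 0.\<close>

lemma initial_set_nonempty: "initial_set \<noteq> {}"
proof
  interpret prob_space "P 0" by (rule prob_space_P) simp
  assume "initial_set = {}"
  then have "(\<integral>U. 1 \<partial>P 0) \<le> (0 :: real)"
    by (intro integral_P_le) (auto simp: initial_set_def)
  moreover have "prob unitary_group = 1" using prob_space by (simp only: space_P)
  ultimately show False by simp
qed

text \<open>Bijectivity of the flow replaces a moving index set by a fixed one: pairs are labelled
  by their starting points, and each pair can be followed in time.\<close>

lemma lohe_D_eq:
  assumes t: "0 \<le> t"
  shows "lohe_D \<rho> F t = (SUP (v, w)\<in>initial_set \<times> initial_set. norm (F t 0 v - F t 0 w))"
proof -
  note inj = bij_betw_imp_inj_on [OF bij_betw_flow [OF t]]
  note surj = bij_betw_imp_surj_on [OF bij_betw_flow [OF t]]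
  have pos: "0 < a * b \<longleftrightarrow> 0 < a \<and> 0 < b" if "0 \<le> a" "0 \<le> b" for a b :: real
    using that by (auto simp: zero_less_mult_iff)
  have "{frobenius_norm (V - W) | V W. V \<in> unitary_group \<and> W \<in> unitary_group \<and>
      \<rho> 0 (inv_into unitary_group (F t 0) V) * \<rho> 0 (inv_into unitary_group (F t 0) W) > 0}
    = (\<lambda>(v, w). norm (F t 0 v - F t 0 w)) ` (initial_set \<times> initial_set)" (is "?A = ?B")
  proof
    show "?A \<subseteq> ?B"
    proof
      fix r assume "r \<in> ?A"
      then obtain V W where VW: "r = norm (V - W)" "V \<in> unitary_group" "W \<in> unitary_group"
        "\<rho> 0 (inv_into unitary_group (F t 0) V) * \<rho> 0 (inv_into unitary_group (F t 0) W) > 0"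
        by (auto simp: norm_eq_frobenius_norm)
      define v w where "v = inv_into unitary_group (F t 0) V" and "w = inv_into unitary_group (F t 0) W"
      have vw: "v \<in> unitary_group" "w \<in> unitary_group" "F t 0 v = V" "F t 0 w = W"
        using VW surj by (auto simp: v_def w_def inv_into_into f_inv_into_f)
      then have "v \<in> initial_set" "w \<in> initial_set"
        using VW(4) pos [OF rho_nonneg rho_nonneg, of 0 v 0 w] by (auto simp: initial_set_def v_def w_def)
      then show "r \<in> ?B" using VW(1) vw by force
    qed
    show "?B \<subseteq> ?A"
    proof
      fix r assume "r \<in> ?B"
      then obtain v w where r: "r = norm (F t 0 v - F t 0 w)" and vw: "v \<in> initial_set" "w \<in> initial_set"
        by auto
      then have "inv_into unitary_group (F t 0) (F t 0 v) = v" "inv_into unitary_group (F t 0) (F t 0 w) = w"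
        using inj by (auto simp: initial_set_def)
      then have "r = frobenius_norm (F t 0 v - F t 0 w) \<and>
          F t 0 v \<in> unitary_group \<and> F t 0 w \<in> unitary_group \<and>
          \<rho> 0 (inv_into unitary_group (F t 0) (F t 0 v)) * \<rho> 0 (inv_into unitary_group (F t 0) (F t 0 w)) > 0"
        using r vw t by (simp add: initial_set_def norm_eq_frobenius_norm flow_in_unitary_group)
      then show "r \<in> ?A" by blast
    qed
  qed
  then show ?thesis unfolding lohe_D_def by simp
qed

lemma norm_flow_le_lohe_D:
  assumes t: "0 \<le> t" and vw: "v \<in> initial_set" "w \<in> initial_set"
  shows "norm (F t 0 v - F t 0 w) \<le> lohe_D \<rho> F t"
proof -
  let ?R = "norm (mat 1 :: complex^'d^'d)"
  have "norm (F t 0 v - F t 0 w) \<le> ?R + ?R" if "v \<in> initial_set" "w \<in> initial_set" for v w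
    using norm_triangle_ineq4 [of "F t 0 v" "F t 0 w"] that t
    by (simp add: initial_set_def norm_unitary flow_in_unitary_group)
  then have bdd: "bdd_above ((\<lambda>(v, w). norm (F t 0 v - F t 0 w)) ` (initial_set \<times> initial_set))"
    by (intro bdd_aboveI2 [of _ _ "?R + ?R"]) auto
  have "(v, w) \<in> initial_set \<times> initial_set" using vw by simp
  from cSUP_upper [OF this bdd] show ?thesis unfolding lohe_D_eq [OF t] by simp
qed

lemma lohe_D_le:
  assumes "0 \<le> t" "\<And>v w. v \<in> initial_set \<Longrightarrow> w \<in> initial_set \<Longrightarrow> norm (F t 0 v - F t 0 w) \<le> c"
  shows "lohe_D \<rho> F t \<le> c"
  unfolding lohe_D_eq [OF assms(1)] using initial_set_nonempty assms(2) by (intro cSUP_least) auto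

lemma lohe_D_nonneg:
  assumes "0 \<le> t"
  shows "0 \<le> lohe_D \<rho> F t"
proof -
  obtain v where "v \<in> initial_set" using initial_set_nonempty by blast
  from norm_flow_le_lohe_D [OF assms this this] show ?thesis by simp
qed

lemma lohe_D_sq_le:
  assumes "0 \<le> t" "\<And>v w. v \<in> initial_set \<Longrightarrow> w \<in> initial_set \<Longrightarrow> (norm (F t 0 v - F t 0 w))\<^sup>2 \<le> c"
  shows "(lohe_D \<rho> F t)\<^sup>2 \<le> c"
proof -
  obtain v where v: "v \<in> initial_set" using initial_set_nonempty by blast
  have "0 \<le> c" using assms(2) [OF v v] by simp
  have "lohe_D \<rho> F t \<le> sqrt c" by (intro lohe_D_le assms real_le_rsqrt)
  then have "(lohe_D \<rho> F t)\<^sup>2 \<le> (sqrt c)\<^sup>2" by (rule power_mono) (rule lohe_D_nonneg [OF assms(1)])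
  then show ?thesis using \<open>0 \<le> c\<close> by simp
qed

lemma norm_flow_sq_le_lohe_D:
  "0 \<le> t \<Longrightarrow> v \<in> initial_set \<Longrightarrow> w \<in> initial_set \<Longrightarrow> (norm (F t 0 v - F t 0 w))\<^sup>2 \<le> (lohe_D \<rho> F t)\<^sup>2"
  by (intro power_mono norm_flow_le_lohe_D) auto

lemma characteristic_initial: "v \<in> initial_set \<Longrightarrow> characteristic (\<lambda>t. F t 0 v)"
  by (rule characteristic_flow) (simp_all add: initial_set_def)

text \<open>The distance bound is uniform over pairs and survives the supremum. Exchanging s and t
  turns it into a bound from below, which gives continuity of D(t)^2 and the lower estimate.\<close>

lemma lohe_D_sq_growth:
  assumes "0 \<le> s" "0 \<le> t"
  shows "(lohe_D \<rho> F t)\<^sup>2 \<le> exp (2 * \<kappa> * \<bar>t - s\<bar>) * (lohe_D \<rho> F s)\<^sup>2"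
proof (rule lohe_D_sq_le [OF \<open>0 \<le> t\<close>])
  fix v w assume vw: "v \<in> initial_set" "w \<in> initial_set"
  have "(norm (F t 0 v - F t 0 w))\<^sup>2 \<le> exp (2 * \<kappa> * \<bar>t - s\<bar>) * (norm (F s 0 v - F s 0 w))\<^sup>2"
    using characteristic_dist_le [OF characteristic_initial characteristic_initial] vw assms by simp
  also have "\<dots> \<le> exp (2 * \<kappa> * \<bar>t - s\<bar>) * (lohe_D \<rho> F s)\<^sup>2"
    by (intro mult_left_mono norm_flow_sq_le_lohe_D vw assms) simp
  finally show "(norm (F t 0 v - F t 0 w))\<^sup>2 \<le> exp (2 * \<kappa> * \<bar>t - s\<bar>) * (lohe_D \<rho> F s)\<^sup>2" .
qed

lemma continuous_on_lohe_D_sq: "continuous_on {0..} (\<lambda>t. (lohe_D \<rho> F t)\<^sup>2)"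
  unfolding continuous_on_def
proof
  fix s :: real assume "s \<in> {0..}"
  then have s: "0 \<le> s" by simp
  let ?E = "\<lambda>t. (lohe_D \<rho> F t)\<^sup>2"
  have ev: "\<forall>\<^sub>F t in at s within {0..}. 0 \<le> t" by (simp add: eventually_at_filter)
  show "(?E \<longlongrightarrow> ?E s) (at s within {0..})"
  proof (rule tendsto_sandwich)
    show "\<forall>\<^sub>F t in at s within {0..}. exp (- (2 * \<kappa> * \<bar>t - s\<bar>)) * ?E s \<le> ?E t"
      using ev
    proof eventually_elim
      case (elim t)
      have "exp (- (2 * \<kappa> * \<bar>t - s\<bar>)) * ?E s
          \<le> exp (- (2 * \<kappa> * \<bar>t - s\<bar>)) * (exp (2 * \<kappa> * \<bar>s - t\<bar>) * ?E t)"
        by (intro mult_left_mono lohe_D_sq_growth s elim) simp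
      also have "\<dots> = ?E t"
        by (simp add: mult.assoc [symmetric] exp_add [symmetric] abs_minus_commute)
      finally show ?case .
    qed
    show "\<forall>\<^sub>F t in at s within {0..}. ?E t \<le> exp (2 * \<kappa> * \<bar>t - s\<bar>) * ?E s"
      using ev by eventually_elim (intro lohe_D_sq_growth s)
    have "((\<lambda>t. exp (- (2 * \<kappa> * \<bar>t - s\<bar>)) * ?E s) \<longlongrightarrow> exp (- (2 * \<kappa> * \<bar>s - s\<bar>)) * ?E s) (at s within {0..})"
      by (intro tendsto_intros)
    then show "((\<lambda>t. exp (- (2 * \<kappa> * \<bar>t - s\<bar>)) * ?E s) \<longlongrightarrow> ?E s) (at s within {0..})" by simp
    have "((\<lambda>t. exp (2 * \<kappa> * \<bar>t - s\<bar>) * ?E s) \<longlongrightarrow> exp (2 * \<kappa> * \<bar>s - s\<bar>) * ?E s) (at s within {0..})"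
      by (intro tendsto_intros)
    then show "((\<lambda>t. exp (2 * \<kappa> * \<bar>t - s\<bar>) * ?E s) \<longlongrightarrow> ?E s) (at s within {0..})" by simp
  qed
qed

text \<open>The logistic inequality in integrated form: an integrating factor built from D is
  applied to each pair, and the supremum is taken last.\<close>

lemma lohe_D_sq_le_exp_integral:
  assumes t: "0 \<le> t"
  shows "(lohe_D \<rho> F t)\<^sup>2
    \<le> (lohe_D \<rho> F 0)\<^sup>2 * exp (- 2 * \<kappa> * integral {0..t} (\<lambda>s. 1 - (lohe_D \<rho> F s)\<^sup>2 / 2))"
proof (rule lohe_D_sq_le [OF t])
  fix v w assume v: "v \<in> initial_set" and w: "w \<in> initial_set"
  define a where "a = (\<lambda>s. 1 - (lohe_D \<rho> F s)\<^sup>2 / 2)"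
  define A where "A t = integral {0..t} a" for t
  define f where "f s = (norm (F s 0 v - F s 0 w))\<^sup>2" for s
  define f' where "f' s = \<kappa> * ((F s 0 v - F s 0 w) \<bullet> (riccati (mean s) (F s 0 v) - riccati (mean s) (F s 0 w)))"
    for s
  have dA: "(A has_real_derivative a s) (at s within {0..})" if "0 \<le> s" for s
    unfolding A_def a_def
    by (rule has_real_derivative_integral [OF _ that]) (auto intro!: continuous_intros continuous_on_lohe_D_sq)
  have df: "(f has_real_derivative f' s) (at s within {0..})" if "0 \<le> s" for s
    unfolding f_def f'_def
    by (rule characteristic_dist_derivative [OF characteristic_initial [OF v] characteristic_initial [OF w] that])
  have G: "F s 0 U \<in> unitary_group" if "0 \<le> s" "U \<in> unitary_group" for s U
    using that by (simp add: flow_in_unitary_group)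
  have f': "f' s \<le> - 2 * \<kappa> * a s * f s" if s: "0 \<le> s" for s
  proof -
    have cont: "continuous_on unitary_group (F s 0)" by (rule continuous_on_flow [OF s])
    \<comment> \<open>Every Z with positive initial density is carried to within D(s) of both
      points, so the sharper bound applies with b = D(s).\<close>
    have "(\<integral>Z. (F s 0 v - F s 0 w) \<bullet> (riccati (F s 0 Z) (F s 0 v) - riccati (F s 0 Z) (F s 0 w)) \<partial>P 0)
        \<le> - 2 * (norm (F s 0 v - F s 0 w))\<^sup>2 * (1 - (lohe_D \<rho> F s)\<^sup>2 / 2)"
    proof (rule integral_P_le)
      fix Z assume "Z \<in> unitary_group" "0 < \<rho> 0 Z"
      then have Z: "Z \<in> initial_set" by (simp add: initial_set_def)
      show "(F s 0 v - F s 0 w) \<bullet> (riccati (F s 0 Z) (F s 0 v) - riccati (F s 0 Z) (F s 0 w))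
          \<le> - 2 * (norm (F s 0 v - F s 0 w))\<^sup>2 * (1 - (lohe_D \<rho> F s)\<^sup>2 / 2)"
        using v w Z s
        by (intro inner_riccati_diff G norm_flow_le_lohe_D) (auto simp: initial_set_def)
    qed (use cont in \<open>auto intro!: continuous_intros\<close>)
    also have "(\<integral>Z. (F s 0 v - F s 0 w) \<bullet> (riccati (F s 0 Z) (F s 0 v) - riccati (F s 0 Z) (F s 0 w)) \<partial>P 0)
        = (F s 0 v - F s 0 w) \<bullet> (riccati (mean s) (F s 0 v) - riccati (mean s) (F s 0 w))"
      unfolding mean_eq [OF s] by (rule inner_riccati_average [symmetric]) (use cont in auto)
    finally have "(F s 0 v - F s 0 w) \<bullet> (riccati (mean s) (F s 0 v) - riccati (mean s) (F s 0 w))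
        \<le> - 2 * f s * a s" by (simp only: f_def a_def)
    then have "f' s \<le> \<kappa> * (- 2 * f s * a s)"
      unfolding f'_def using kappa by (intro mult_left_mono) auto
    then show ?thesis by (simp add: mult_ac)
  qed
  \<comment> \<open>The factor \<open>exp (2 * \<kappa> * A s)\<close> absorbs the variable rate a
    and leaves a nonincreasing function: Gronwall with c = 0.\<close>
  have "exp (2 * \<kappa> * A t) * f t \<le> exp (0 * (t - 0)) * (exp (2 * \<kappa> * A 0) * f 0)"
  proof (rule exponential_bound [OF _ _ order_refl t])
    show "((\<lambda>s. exp (2 * \<kappa> * A s) * f s) has_real_derivative
        exp (2 * \<kappa> * A s) * (2 * \<kappa> * a s * f s + f' s)) (at s within {0..})" if "0 \<le> s" for s
      by (auto intro!: derivative_eq_intros dA df that simp: algebra_simps)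
    show "exp (2 * \<kappa> * A s) * (2 * \<kappa> * a s * f s + f' s) \<le> 0 * (exp (2 * \<kappa> * A s) * f s)" if "0 \<le> s" for s
      using f' [OF that] by (simp add: mult_le_0_iff)
  qed
  then have "exp (2 * \<kappa> * A t) * f t \<le> f 0" by (simp add: A_def)
  then have "exp (- 2 * \<kappa> * A t) * (exp (2 * \<kappa> * A t) * f t) \<le> exp (- 2 * \<kappa> * A t) * f 0"
    by (intro mult_left_mono) auto
  also have "exp (- 2 * \<kappa> * A t) * (exp (2 * \<kappa> * A t) * f t) = f t"
    by (simp add: mult.assoc [symmetric] exp_add [symmetric])
  also have "exp (- 2 * \<kappa> * A t) * f 0 \<le> exp (- 2 * \<kappa> * A t) * (lohe_D \<rho> F 0)\<^sup>2"
    unfolding f_def by (intro mult_left_mono norm_flow_sq_le_lohe_D v w) auto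
  finally show "(norm (F t 0 v - F t 0 w))\<^sup>2
      \<le> (lohe_D \<rho> F 0)\<^sup>2 * exp (- 2 * \<kappa> * integral {0..t} (\<lambda>s. 1 - (lohe_D \<rho> F s)\<^sup>2 / 2))"
    by (simp add: f_def A_def a_def mult.commute)
qed

text \<open>A tent function over a ball that misses the transported set vanishes along the flow, so
  by transport its integral against \<open>P t\<close> is 0. The ball is then a null set and its
  centre is not in the support.\<close>

lemma density_support_subset:
  assumes t: "0 \<le> t"
  shows "density_support \<mu> (\<rho> t) \<subseteq> closure (F t 0 ` initial_set)"
proof (rule subsetI, rule ccontr)
  fix x assume x: "x \<in> density_support \<mu> (\<rho> t)" and "x \<notin> closure (F t 0 ` initial_set)"
  then obtain e where e: "0 < e" "\<And>v. v \<in> initial_set \<Longrightarrow> e \<le> dist (F t 0 v) x"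
    unfolding closure_approachable by (auto simp: not_less)
  interpret prob_space "P t" by (rule prob_space_P [OF t])
  define f where "f y = max 0 (e - dist y x)" for y
  have cont: "continuous_on UNIV f" unfolding f_def by (intro continuous_intros)
  then have cont': "continuous_on unitary_group f" by (rule continuous_on_subset) simp
  have "(\<integral>U. f U \<partial>P t) = (\<integral>U. f (F t 0 U) \<partial>P 0)" by (rule integral_transport [OF t cont])
  also have "\<dots> \<le> 0"
    by (intro integral_P_le continuous_on_compose_flow [OF t cont'])
      (use e(2) in \<open>auto simp: f_def initial_set_def\<close>)
  finally have "(\<integral>U. f U \<partial>P t) \<le> 0" .
  moreover have "0 \<le> (\<integral>U. f U \<partial>P t)" by (rule integral_P_ge [OF t cont']) (simp add: f_def)
  ultimately have "(\<integral>U. f U \<partial>P t) = 0" by (rule antisym)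
  moreover have "AE U in P t. 0 \<le> f U" by (simp add: f_def)
  ultimately have ae: "AE U in P t. f U = 0"
    using integral_nonneg_eq_0_iff_AE [OF integrable_P [OF t cont']] by blast
  have meas: "ball x e \<inter> unitary_group \<in> sets (P t)"
    by (auto simp: sets_mu sets_restrict_space)
  have "{U \<in> space (P t). f U \<noteq> 0} = ball x e \<inter> unitary_group"
    by (auto simp: f_def dist_commute max_def)
  from AE_iff_measurable [OF meas this] ae
  have "emeasure (P t) (ball x e \<inter> unitary_group) = 0" by simp
  moreover have "0 < emeasure (P t) (ball x e \<inter> space (P t))"
    using x e(1) unfolding density_support_def measure_support_def P_def by simp
  ultimately show False by simp
qed

lemma diameter_density_support_le:
  assumes t: "0 \<le> t"
  shows "diameter (density_support \<mu> (\<rho> t)) \<le> lohe_D \<rho> F t"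
proof -
  have "F t 0 ` initial_set \<subseteq> unitary_group"
    using t by (auto simp: initial_set_def flow_in_unitary_group)
  then have b: "bounded (F t 0 ` initial_set)"
    using compact_unitary_group compact_imp_bounded bounded_subset by blast
  have "diameter (density_support \<mu> (\<rho> t)) \<le> diameter (closure (F t 0 ` initial_set))"
    by (intro diameter_subset density_support_subset t bounded_closure b)
  also have "\<dots> = diameter (F t 0 ` initial_set)" by (rule diameter_closure [OF b])
  also have "\<dots> \<le> lohe_D \<rho> F t"
    by (rule diameter_le) (use initial_set_nonempty in \<open>auto intro: norm_flow_le_lohe_D t\<close>)
  finally show ?thesis .
qed

lemma diameter_density_support_nonneg: "0 \<le> diameter (density_support \<mu> (\<rho> t))"
proof -
  have "density_support \<mu> (\<rho> t) \<subseteq> space (P t)"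
    by (auto simp: density_support_def measure_support_def P_def)
  then have "density_support \<mu> (\<rho> t) \<subseteq> unitary_group"
    by (simp only: space_P)
  then have "bounded (density_support \<mu> (\<rho> t))"
    by (rule bounded_subset [OF compact_imp_bounded [OF compact_unitary_group]])
  then show ?thesis by (rule diameter_ge_0)
qed

end

theorem theorem4p1:
  fixes \<kappa> :: real
    and \<mu> :: "(complex^'d^'d) measure"
    and \<rho> :: "real \<Rightarrow> complex^'d^'d \<Rightarrow> real"
    and F :: "real \<Rightarrow> real \<Rightarrow> complex^'d^'d \<Rightarrow> complex^'d^'d"
  assumes haar: "normalized_haar \<mu>"
    and density: "\<And>t. t \<ge> 0 \<Longrightarrow> prob_density \<mu> (\<rho> t)"
    and continuity: "weakly_continuous_in_time \<mu> \<rho>"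
    and solution: "lohe_weak_solution \<kappa> \<mu> \<rho>"
    and flow: "lohe_flow \<kappa> \<mu> \<rho> F"
    and kappa: "\<kappa> > 0"
    and D0: "0 \<le> lohe_D \<rho> F 0" "lohe_D \<rho> F 0 < sqrt 2"
  shows "((\<lambda>t. diameter (density_support \<mu> (\<rho> t))) \<longlongrightarrow> 0) at_top \<and>
    (\<forall>t\<ge>0.
       (lohe_D \<rho> F 0)\<^sup>2 * exp (- 2 * \<kappa> * t) *
         (1 - 1 / 2 * (lohe_D \<rho> F 0)\<^sup>2 * (1 - exp (- 2 * \<kappa> * t)))
         \<le> (lohe_D \<rho> F t)\<^sup>2 \<and>
       (lohe_D \<rho> F t)\<^sup>2
         \<le> 2 * (lohe_D \<rho> F 0)\<^sup>2 /
           ((2 - (lohe_D \<rho> F 0)\<^sup>2) * exp (2 * \<kappa> * t) + (lohe_D \<rho> F 0)\<^sup>2))"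
proof -
  interpret lohe_solution \<kappa> \<mu> \<rho> F
    by unfold_locales fact+
  let ?E = "\<lambda>t. (lohe_D \<rho> F t)\<^sup>2"
  have E0: "?E 0 < 2" using D0 power_strict_mono [of "lohe_D \<rho> F 0" "sqrt 2" 2] by simp
  have lower: "?E 0 * exp (- 2 * \<kappa> * t) * (1 - 1 / 2 * ?E 0 * (1 - exp (- 2 * \<kappa> * t))) \<le> ?E t"
    if t: "0 \<le> t" for t
  proof -
    \<comment> \<open>The last bracket is at most 1, so the claim follows from the purely
      exponential lower bound for \<open>?E t\<close>.\<close>
    have "?E 0 * exp (- 2 * \<kappa> * t) * (1 - 1 / 2 * ?E 0 * (1 - exp (- 2 * \<kappa> * t)))
        \<le> ?E 0 * exp (- 2 * \<kappa> * t) * 1"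
      using t kappa by (intro mult_left_mono) auto
    also have "\<dots> \<le> (exp (2 * \<kappa> * t) * ?E t) * exp (- 2 * \<kappa> * t)"
      using lohe_D_sq_growth [of t 0] t by simp
    also have "\<dots> = ?E t" by (simp add: exp_minus)
    finally show ?thesis .
  qed
  have upper: "?E t \<le> 2 * ?E 0 / ((2 - ?E 0) * exp (2 * \<kappa> * t) + ?E 0)" if "0 \<le> t" for t
    by (rule logistic_bound [OF continuous_on_lohe_D_sq kappa _ E0 lohe_D_sq_le_exp_integral that]) simp
  have "(?E \<longlongrightarrow> 0) at_top"
  proof (rule tendsto_sandwich [OF _ _ tendsto_const])
    show "\<forall>\<^sub>F t in at_top. 0 \<le> ?E t" by simp
    show "\<forall>\<^sub>F t in at_top. ?E t \<le> 2 * ?E 0 / ((2 - ?E 0) * exp (2 * \<kappa> * t) + ?E 0)"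
      using eventually_ge_at_top [of 0] by eventually_elim (rule upper)
    have "filterlim (\<lambda>t. exp (2 * \<kappa> * t)) at_top at_top"
      using kappa by (intro filterlim_compose [OF exp_at_top] filterlim_tendsto_pos_mult_at_top
          [OF tendsto_const _ filterlim_ident]) simp
    \<comment> \<open>The condition D(0)^2 < 2 makes the coefficient of the exponential
      positive.\<close>
    then have "filterlim (\<lambda>t. (2 - ?E 0) * exp (2 * \<kappa> * t)) at_top at_top"
      using E0 by (intro filterlim_tendsto_pos_mult_at_top [OF tendsto_const]) simp
    then have "filterlim (\<lambda>t. ?E 0 + (2 - ?E 0) * exp (2 * \<kappa> * t)) at_top at_top"
      by (rule filterlim_tendsto_add_at_top [OF tendsto_const])
    then show "((\<lambda>t. 2 * ?E 0 / ((2 - ?E 0) * exp (2 * \<kappa> * t) + ?E 0)) \<longlongrightarrow> 0) at_top"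
      by (intro tendsto_divide_0 [OF tendsto_const] filterlim_at_top_imp_at_infinity)
        (simp add: add.commute)
  qed
  then have sqrt: "((\<lambda>t. sqrt (?E t)) \<longlongrightarrow> 0) at_top"
    using tendsto_real_sqrt by fastforce
  have "((\<lambda>t. diameter (density_support \<mu> (\<rho> t))) \<longlongrightarrow> 0) at_top"
  proof (rule tendsto_sandwich [OF _ _ tendsto_const sqrt])
    show "\<forall>\<^sub>F t in at_top. 0 \<le> diameter (density_support \<mu> (\<rho> t))"
      using diameter_density_support_nonneg by simp
    show "\<forall>\<^sub>F t in at_top. diameter (density_support \<mu> (\<rho> t)) \<le> sqrt (?E t)"
      using eventually_ge_at_top [of 0]
    proof eventually_elim
      case (elim t)
      then show ?case using diameter_density_support_le lohe_D_nonneg by simp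
    qed
  qed
  with lower upper show ?thesis by blast
qed

end
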